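(* Let $G$ be a Polish group and $X$ a Polish $G$-space. Suppose that for every $G$-invariant dense $G_\delta$ subset $C$ of $X$ there exist $x,y\in C$ with different $G$-orbits such that $x\preccurlyeq_{\mathcal{B}}y$. Then for every $G$-invariant dense $G_\delta$ subset $C$ of $X$, the restriction of the orbit equivalence relation $E_G^X$ to $C$ is not CLI-classifiable.
   Context: A Polish $G$-space is a Polish space with a continuous action of $G$; $E_G^X$ is its orbit equivalence relation. A CLI group is a Polish group admitting a compatible complete left-invariant metric. An equivalence relation $E$ on a Polish (or standard Borel) space is CLI-classifiable if it is Borel reducible to the orbit equivalence relation $E_H^Y$ of some CLI group $H$ acting continuously on some Polish space $Y$. For $x,y\in X$, $x\preccurlyeq_{\mathcal{B}}y$ means Player II has a winning strategy in the Becker-embedding game $\mathrm{Emb}(x,y)$: set $U_0=X$, $V_0=G$; at the $n$-th turn ($n\ge1$) Player I plays an open neighborhood $U_n$ of $x$ and an open neighborhood $V_n$ of the identity of $G$, and Player II responds with $g_{n-1}\in V_{n-1}$; Player II wins if for every $n>0$, $g_{n-1}\cdots g_0y\in U_n$. *)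

theory Defs
  imports "HOL-Analysis.Analysis" "HOL-Algebra.Group_Action"
begin

definition polish_topology :: "'a topology \<Rightarrow> bool" where
  "polish_topology X \<longleftrightarrow> completely_metrizable_space X \<and> separable_space X"

definition polish_group :: "('g, 'm) monoid_scheme \<Rightarrow> 'g topology \<Rightarrow> bool" where
  "polish_group G T \<longleftrightarrow>
     group G \<and> topspace T = carrier G \<and> polish_topology T \<and>
     continuous_map (prod_topology T T) T (\<lambda>(g, h). g \<otimes>\<^bsub>G\<^esub> h) \<and>
     continuous_map T T (\<lambda>g. inv\<^bsub>G\<^esub> g)"

definition cli_group :: "('g, 'm) monoid_scheme \<Rightarrow> 'g topology \<Rightarrow> bool" where
  "cli_group G T \<longleftrightarrow>
     polish_group G T \<and>
     (\<exists>d. Metric_space (carrier G) d \<and>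
          Metric_space.mtopology (carrier G) d = T \<and>
          Metric_space.mcomplete (carrier G) d \<and>
          (\<forall>g\<in>carrier G. \<forall>h\<in>carrier G. \<forall>k\<in>carrier G.
             d (g \<otimes>\<^bsub>G\<^esub> h) (g \<otimes>\<^bsub>G\<^esub> k) = d h k))"

definition polish_G_space ::
  "('g, 'm) monoid_scheme \<Rightarrow> 'g topology \<Rightarrow> 'x topology \<Rightarrow> ('g \<Rightarrow> 'x \<Rightarrow> 'x) \<Rightarrow> bool" where
  "polish_G_space G T X \<phi> \<longleftrightarrow>
     polish_topology X \<and> group_action G (topspace X) \<phi> \<and>
     continuous_map (prod_topology T X) X (\<lambda>(g, x). \<phi> g x)"

definition orbit_eq_rel ::
  "('g, 'm) monoid_scheme \<Rightarrow> 'x topology \<Rightarrow> ('g \<Rightarrow> 'x \<Rightarrow> 'x) \<Rightarrow> ('x \<times> 'x) set" where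
  "orbit_eq_rel G X \<phi> =
     {(x, y). x \<in> topspace X \<and> y \<in> topspace X \<and> orbit G \<phi> x = orbit G \<phi> y}"

definition invariant_dense_gdelta ::
  "('g, 'm) monoid_scheme \<Rightarrow> 'x topology \<Rightarrow> ('g \<Rightarrow> 'x \<Rightarrow> 'x) \<Rightarrow> 'x set \<Rightarrow> bool" where
  "invariant_dense_gdelta G X \<phi> C \<longleftrightarrow>
     gdelta_in X C \<and> X closure_of C = topspace X \<and>
     (\<forall>g\<in>carrier G. \<forall>x\<in>C. \<phi> g x \<in> C)"

definition borel_of :: "'a topology \<Rightarrow> 'a measure" where
  "borel_of X = sigma (topspace X) {U. openin X U}"

definition borel_reducible ::
  "'a measure \<Rightarrow> ('a \<times> 'a) set \<Rightarrow> 'b measure \<Rightarrow> ('b \<times> 'b) set \<Rightarrow> bool" where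
  "borel_reducible M E N F \<longleftrightarrow>
     (\<exists>f \<in> measurable M N.
        \<forall>x\<in>space M. \<forall>y\<in>space M. (x, y) \<in> E \<longleftrightarrow> (f x, f y) \<in> F)"

text \<open>
  HOL cannot quantify over types inside a formula, so the types \<open>'h\<close> and \<open>'y\<close> which contain the
  carriers of the classifying group and of the space it acts on are explicit parameters. A
  statement of non-classifiability has to be made for arbitrary type variables \<open>'h\<close> and \<open>'y\<close>.
\<close>

definition cli_classifiable ::
  "'h itself \<Rightarrow> 'y itself \<Rightarrow> 'a measure \<Rightarrow> ('a \<times> 'a) set \<Rightarrow> bool" where
  "cli_classifiable (_ :: 'h itself) (_ :: 'y itself) M E \<longleftrightarrow>
     (\<exists>(H :: 'h monoid) T (Y :: 'y topology) \<psi>.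
        cli_group H T \<and> polish_G_space H T Y \<psi> \<and>
        borel_reducible M E (borel_of Y) (orbit_eq_rel H Y \<psi>))"

text \<open>The product \<open>g\<^bsub>n-1\<^esub> \<cdots> g\<^sub>0\<close>.\<close>

primrec left_prod :: "('g, 'm) monoid_scheme \<Rightarrow> (nat \<Rightarrow> 'g) \<Rightarrow> nat \<Rightarrow> 'g" where
  "left_prod G g 0 = \<one>\<^bsub>G\<^esub>"
| "left_prod G g (Suc n) = g n \<otimes>\<^bsub>G\<^esub> left_prod G g n"

definition emb_legal_I ::
  "('g, 'm) monoid_scheme \<Rightarrow> 'g topology \<Rightarrow> 'x topology \<Rightarrow> 'x \<Rightarrow>
   (nat \<Rightarrow> 'x set) \<Rightarrow> (nat \<Rightarrow> 'g set) \<Rightarrow> bool" where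
  "emb_legal_I G T X x U V \<longleftrightarrow>
     U 0 = topspace X \<and> V 0 = carrier G \<and>
     (\<forall>n\<ge>1. openin X (U n) \<and> x \<in> U n \<and> openin T (V n) \<and> \<one>\<^bsub>G\<^esub> \<in> V n)"

text \<open>
  A strategy for Player II maps the finite sequence of moves made so far by Player I to an element
  of the group: at turn \<open>n + 1\<close> Player I has played \<open>(U\<^sub>1, V\<^sub>1), \<dots>, (U\<^bsub>n+1\<^esub>, V\<^bsub>n+1\<^esub>)\<close>, and
  Player II answers with \<open>g\<^sub>n\<close>.
\<close>

definition emb_response ::
  "(('x set \<times> 'g set) list \<Rightarrow> 'g) \<Rightarrow> (nat \<Rightarrow> 'x set) \<Rightarrow> (nat \<Rightarrow> 'g set) \<Rightarrow> nat \<Rightarrow> 'g" where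
  "emb_response \<sigma> U V n = \<sigma> (map (\<lambda>i. (U i, V i)) [1..<n + 2])"

definition becker_embeds ::
  "('g, 'm) monoid_scheme \<Rightarrow> 'g topology \<Rightarrow> 'x topology \<Rightarrow> ('g \<Rightarrow> 'x \<Rightarrow> 'x) \<Rightarrow>
   'x \<Rightarrow> 'x \<Rightarrow> bool" where
  "becker_embeds G T X \<phi> x y \<longleftrightarrow>
     (\<exists>\<sigma>. \<forall>U V. emb_legal_I G T X x U V \<longrightarrow>
        (\<forall>n\<ge>1. emb_response \<sigma> U V (n - 1) \<in> V (n - 1)) \<and>
        (\<forall>n\<ge>1. \<phi> (left_prod G (emb_response \<sigma> U V) n) y \<in> U n))"

end

theory Submission
  imports Defs
begin

text \<open>
  Let \<open>f\<close> be a Borel reduction of the orbit equivalence relation on an invariant dense \<open>G\<^sub>\<delta>\<close> set to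
  an action of a group \<open>H\<close> with complete left-invariant metric \<open>d\<close>. It is continuous on a comeager
  set. Since \<open>f (g z)\<close> lies in \<open>H f(z)\<close>, and \<open>H\<close> is covered by countably many translates of a small
  neighbourhood of \<open>1\<close>, the Baire property of analytic sets and the Kuratowski-Ulam theorem yield a
  comeager \<open>C'\<close> such that every \<open>x \<in> C'\<close> and \<open>\<epsilon> > 0\<close> admit neighbourhoods \<open>U\<close> of \<open>x\<close> and \<open>V\<close> of \<open>1\<close>
  with \<open>f (g z) = w f(z)\<close>, \<open>d 1 w \<le> \<epsilon>\<close>, for all \<open>z \<in> C' \<inter> U\<close> and comeagerly many \<open>g \<in> V\<close>.

  The points \<open>z\<close> with \<open>g z \<in> C'\<close> for comeagerly many \<open>g\<close> form an invariant dense \<open>G\<^sub>\<delta>\<close> set \<open>D\<close>. Let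
  \<open>x, y \<in> D\<close> have different orbits with \<open>x\<close> Becker-embedding into \<open>y\<close>; we may take \<open>x \<in> C'\<close>. Let
  Player I play the neighbourhoods above for \<open>\<epsilon> = 2\<^sup>-\<^sup>n\<close>. After small perturbations into \<open>C'\<close>, the
  positions \<open>y\<^sub>n\<close> of the play satisfy \<open>f (y\<^sub>n\<^sub>+\<^sub>1) = w\<^sub>n f(y\<^sub>n)\<close> with \<open>d 1 w\<^sub>n \<le> 2\<^sup>-\<^sup>n\<close>, and
  \<open>f (y\<^sub>n)\<close> tends to \<open>f x\<close>. By completeness the inverses of \<open>w\<^sub>n \<cdots> w\<^sub>0\<close> converge, so \<open>f x\<close> lies in
  the orbit of \<open>f y\<close>, a contradiction.
\<close>

section \<open>Baire category in abstract topologies\<close>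

text \<open>Closed covers replace nowhere dense pieces because this is the form that
  \<open>Baire_category_alt\<close> takes. A meager set is automatically a subset of the
  space.\<close>

definition meager_in :: "'a topology \<Rightarrow> 'a set \<Rightarrow> bool" where
  "meager_in X S \<longleftrightarrow>
     (\<exists>\<F>. countable \<F> \<and> (\<forall>F\<in>\<F>. closedin X F \<and> X interior_of F = {}) \<and> S \<subseteq> \<Union>\<F>)"

lemma meager_in_mono: "meager_in X S \<Longrightarrow> R \<subseteq> S \<Longrightarrow> meager_in X R"
  unfolding meager_in_def by (meson subset_trans)

lemma meager_in_empty [simp]: "meager_in X {}"
  unfolding meager_in_def by (rule exI[of _ "{}"]) auto

lemma meager_in_closed: "closedin X F \<Longrightarrow> X interior_of F = {} \<Longrightarrow> meager_in X F"
  unfolding meager_in_def by (rule exI[of _ "{F}"]) auto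

lemma meager_in_UN:
  assumes "countable I" and "\<And>i. i \<in> I \<Longrightarrow> meager_in X (S i)"
  shows "meager_in X (\<Union>i\<in>I. S i)"
proof -
  obtain \<F> where \<F>: "\<And>i. i \<in> I \<Longrightarrow> countable (\<F> i) \<and>
      (\<forall>F\<in>\<F> i. closedin X F \<and> X interior_of F = {}) \<and> S i \<subseteq> \<Union>(\<F> i)"
    using assms(2) unfolding meager_in_def by metis
  show ?thesis unfolding meager_in_def
  proof (intro exI conjI)
    show "countable (\<Union>i\<in>I. \<F> i)" using assms(1) \<F> by blast
    show "\<forall>F\<in>(\<Union>i\<in>I. \<F> i). closedin X F \<and> X interior_of F = {}" using \<F> by blast
    show "(\<Union>i\<in>I. S i) \<subseteq> \<Union>(\<Union>i\<in>I. \<F> i)" using \<F> by fastforce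
  qed
qed

lemma meager_in_Un:
  assumes "meager_in X S" "meager_in X R"
  shows "meager_in X (S \<union> R)"
proof -
  have "meager_in X (\<Union>b\<in>UNIV. if b then S else R)"
    by (rule meager_in_UN) (use assms in auto)
  moreover have "(\<Union>b\<in>UNIV. if b then S else R) = S \<union> R"
    by (auto split: if_splits)
  ultimately show ?thesis by simp
qed

lemma meager_in_open_imp_empty:
  assumes "completely_metrizable_space X" "openin X U" "meager_in X U"
  shows "U = {}"
proof -
  obtain \<F> where \<F>: "countable \<F>" "\<And>F. F \<in> \<F> \<Longrightarrow> closedin X F \<and> X interior_of F = {}" "U \<subseteq> \<Union>\<F>"
    using assms(3) unfolding meager_in_def by blast
  have "X interior_of \<Union>\<F> = {}"
    using Baire_category_alt[of X \<F>] \<F> assms(1) by blast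
  with interior_of_maximal[OF \<F>(3) assms(2)] show ?thesis by blast
qed

text \<open>The form in which the Baire category theorem serves the later choices of generic points:
  a requirement that holds off a meager set can be met inside any nonempty open set.\<close>

lemma ex_not_in_meager:
  assumes "completely_metrizable_space X" "openin X U" "U \<noteq> {}" "meager_in X S"
  obtains x where "x \<in> U" "x \<notin> S"
  using meager_in_open_imp_empty[OF assms(1,2)] meager_in_mono[OF assms(4)] assms(3) by blast

lemma meager_in_homeomorphic_vimage:
  assumes h: "homeomorphic_map X Y h" and S: "meager_in Y S"
  shows "meager_in X {x \<in> topspace X. h x \<in> S}"
proof -
  obtain \<F> where \<F>: "countable \<F>" "\<And>F. F \<in> \<F> \<Longrightarrow> closedin Y F \<and> Y interior_of F = {}" "S \<subseteq> \<Union>\<F>"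
    using S unfolding meager_in_def by blast
  have cont: "continuous_map X Y h" and img: "h ` topspace X = topspace Y"
    using h by (simp_all add: homeomorphic_imp_continuous_map homeomorphic_imp_surjective_map)
  let ?v = "\<lambda>F. {x \<in> topspace X. h x \<in> F}"
  have "X interior_of ?v F = {}" if "F \<in> \<F>" for F
  proof -
    have "h ` ?v F = F"
      using \<F>(2)[OF that] img closedin_subset by fastforce
    then have "h ` (X interior_of ?v F) = {}"
      using homeomorphic_map_interior_of[OF h, of "?v F"] \<F>(2)[OF that] by auto
    then show ?thesis by simp
  qed
  moreover have "closedin X (?v F)" if "F \<in> \<F>" for F
    using closedin_continuous_map_preimage[OF cont] \<F>(2)[OF that] by blast
  ultimately show ?thesis unfolding meager_in_def
    by (intro exI[of _ "?v ` \<F>"]) (use \<F> in auto)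
qed

lemma meager_in_Times:
  assumes "meager_in Y S"
  shows "meager_in (prod_topology X Y) (topspace X \<times> S)"
proof -
  obtain \<F> where \<F>: "countable \<F>" "\<And>F. F \<in> \<F> \<Longrightarrow> closedin Y F \<and> Y interior_of F = {}" "S \<subseteq> \<Union>\<F>"
    using assms unfolding meager_in_def by blast
  show ?thesis unfolding meager_in_def
  proof (intro exI[of _ "(\<lambda>F. topspace X \<times> F) ` \<F>"] conjI ballI)
    show "countable ((\<lambda>F. topspace X \<times> F) ` \<F>)" using \<F> by blast
    show "topspace X \<times> S \<subseteq> \<Union> ((\<lambda>F. topspace X \<times> F) ` \<F>)" using \<F>(3) by fastforce
  next
    fix F' assume "F' \<in> (\<lambda>F. topspace X \<times> F) ` \<F>"
    then obtain F where F: "F \<in> \<F>" "F' = topspace X \<times> F" by blast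
    then show "closedin (prod_topology X Y) F'" "prod_topology X Y interior_of F' = {}"
      using \<F>(2) by (auto simp: closedin_prod_Times_iff interior_of_Times)
  qed
qed

text \<open>One half of the Kuratowski-Ulam theorem. If \<open>F\<close> is closed with empty
  interior and \<open>V\<close> is a nonempty basic open set, the \<open>y\<close> with
  \<open>V \<times> {y} \<subseteq> F\<close> form a closed set with empty interior, for otherwise
  \<open>F\<close> would contain an open box. Off these countably many sets every section of every
  \<open>F\<close> is nowhere dense.\<close>

lemma meager_in_sections:
  assumes sc: "second_countable X" and N: "meager_in (prod_topology X Y) N"
  shows "meager_in Y {y \<in> topspace Y. \<not> meager_in X {x. (x, y) \<in> N}}"
proof -
  obtain \<B> where \<B>: "countable \<B>" "\<And>V. V \<in> \<B> \<Longrightarrow> openin X V"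
      "\<And>U x. openin X U \<Longrightarrow> x \<in> U \<Longrightarrow> \<exists>V\<in>\<B>. x \<in> V \<and> V \<subseteq> U"
    using sc unfolding second_countable_def by metis
  obtain \<F> where \<F>: "countable \<F>" "N \<subseteq> \<Union>\<F>"
      "\<And>F. F \<in> \<F> \<Longrightarrow> closedin (prod_topology X Y) F \<and> prod_topology X Y interior_of F = {}"
    using N unfolding meager_in_def by blast
  define Z :: "('a \<times> 'b) set \<Rightarrow> 'a set \<Rightarrow> 'b set" where "Z F V = {y \<in> topspace Y. V \<times> {y} \<subseteq> F}" for F V
  have Z: "meager_in Y (Z F V)" if F: "F \<in> \<F>" and V: "V \<in> \<B> - {{}}" for F V
  proof (rule meager_in_closed)
    have VX: "V \<subseteq> topspace X" using \<B>(2) V openin_subset by blast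
    have "Z F V = topspace Y \<inter> (\<Inter>x\<in>V. {y \<in> topspace Y. (x, y) \<in> F})"
      unfolding Z_def by auto
    moreover have "closedin Y {y \<in> topspace Y. (x, y) \<in> F}" if "x \<in> V" for x
    proof (rule closedin_continuous_map_preimage[where Y = "prod_topology X Y"])
      show "continuous_map Y (prod_topology X Y) (Pair x)"
        using that VX by (auto intro!: continuous_map_pairedI)
    qed (use \<F>(3)[OF F] in simp)
    ultimately show "closedin Y (Z F V)"
      using V by (auto intro!: closedin_Int closedin_Inter)
    have "V \<times> (Y interior_of Z F V) \<subseteq> F"
      using interior_of_subset[of Y "Z F V"] unfolding Z_def by auto
    moreover have "openin (prod_topology X Y) (V \<times> (Y interior_of Z F V))"
      using \<B>(2) V by (simp add: openin_prod_Times_iff)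
    ultimately have "V \<times> (Y interior_of Z F V) \<subseteq> {}"
      using interior_of_maximal \<F>(3)[OF F] by metis
    then show "Y interior_of Z F V = {}" using V by auto
  qed
  have "meager_in Y (\<Union>F\<in>\<F>. \<Union>V\<in>\<B> - {{}}. Z F V)"
    using Z \<F>(1) \<B>(1) by (intro meager_in_UN) auto
  moreover have "{y \<in> topspace Y. \<not> meager_in X {x. (x, y) \<in> N}} \<subseteq> (\<Union>F\<in>\<F>. \<Union>V\<in>\<B> - {{}}. Z F V)"
  proof (intro subsetI, rule ccontr)
    fix y assume y: "y \<in> {y \<in> topspace Y. \<not> meager_in X {x. (x, y) \<in> N}}"
      and "y \<notin> (\<Union>F\<in>\<F>. \<Union>V\<in>\<B> - {{}}. Z F V)"
    then have nz: "\<not> V \<times> {y} \<subseteq> F" if "F \<in> \<F>" "V \<in> \<B>" "V \<noteq> {}" for F V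
      using that unfolding Z_def by blast
    have "meager_in X (\<Union>F\<in>\<F>. {x \<in> topspace X. (x, y) \<in> F})"
    proof (intro meager_in_UN \<F>(1) meager_in_closed)
      fix F assume F: "F \<in> \<F>"
      have "continuous_map X (prod_topology X Y) (\<lambda>x. (x, y))"
        using y by (auto intro!: continuous_map_pairedI)
      then show "closedin X {x \<in> topspace X. (x, y) \<in> F}"
        by (rule closedin_continuous_map_preimage) (use \<F>(3)[OF F] in simp)
      show "X interior_of {x \<in> topspace X. (x, y) \<in> F} = {}"
      proof (rule ccontr)
        assume "X interior_of {x \<in> topspace X. (x, y) \<in> F} \<noteq> {}"
        then obtain x where "x \<in> X interior_of {x \<in> topspace X. (x, y) \<in> F}" by blast
        from \<B>(3)[OF openin_interior_of this]
        obtain V where "x \<in> V" "V \<in> \<B>" "V \<subseteq> X interior_of {x \<in> topspace X. (x, y) \<in> F}" by blast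
        then show False
          using nz[OF F, of V] interior_of_subset[of X "{x \<in> topspace X. (x, y) \<in> F}"] by blast
      qed
    qed
    moreover have "{x. (x, y) \<in> N} \<subseteq> (\<Union>F\<in>\<F>. {x \<in> topspace X. (x, y) \<in> F})"
    proof
      fix x assume "x \<in> {x. (x, y) \<in> N}"
      then obtain F where F: "F \<in> \<F>" "(x, y) \<in> F" using \<F>(2) by blast
      moreover have "F \<subseteq> topspace X \<times> topspace Y"
        using closedin_subset[of "prod_topology X Y" F] \<F>(3)[OF F(1)] by simp
      ultimately show "x \<in> (\<Union>F\<in>\<F>. {x \<in> topspace X. (x, y) \<in> F})" by fast
    qed
    ultimately have "meager_in X {x. (x, y) \<in> N}" by (rule meager_in_mono)
    then show False using y by simp
  qed
  ultimately show ?thesis by (rule meager_in_mono)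
qed

lemma meager_in_sections':
  assumes sc: "second_countable Y" and N: "meager_in (prod_topology X Y) N"
  shows "meager_in X {x \<in> topspace X. \<not> meager_in Y {y. (x, y) \<in> N}}"
proof -
  have "homeomorphic_map (prod_topology Y X) (prod_topology X Y) (\<lambda>(x, y). (y, x))"
    by (rule homeomorphic_map_swap)
  from meager_in_homeomorphic_vimage[OF this N]
  have "meager_in (prod_topology Y X) {q \<in> topspace (prod_topology Y X). prod.swap q \<in> N}"
    by (rule meager_in_mono) auto
  note m = meager_in_sections[OF sc this]
  \<comment> \<open>Needed because the swapped set was cut down to the product space; a meager set
    lies there anyway, so its sections are unchanged.\<close>
  have N': "N \<subseteq> topspace (prod_topology X Y)"
    using N closedin_subset unfolding meager_in_def by blast
  have "{y. (y, x) \<in> {q \<in> topspace (prod_topology Y X). prod.swap q \<in> N}} = {y. (x, y) \<in> N}" for x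
    using N' by auto
  then show ?thesis using m by simp
qed

section \<open>Countable bases and comeager sets\<close>

lemma metrizable_separable_imp_second_countable:
  assumes "metrizable_space X" "separable_space X"
  shows "second_countable X"
proof -
  obtain M d where Md: "Metric_space M d" and X: "X = Metric_space.mtopology M d"
    using assms(1) unfolding metrizable_space_def by blast
  interpret Metric_space M d by (rule Md)
  obtain C where C: "countable C" "C \<subseteq> M" "mtopology closure_of C = M"
    using assms(2) unfolding separable_space_def X by auto
  define \<B> where "\<B> = (\<lambda>(c, n::nat). mball c (inverse (real (Suc n)))) ` (C \<times> UNIV)"
  show ?thesis unfolding second_countable_def
  proof (intro exI[of _ \<B>] conjI ballI allI impI)
    show "countable \<B>" unfolding \<B>_def using C(1) by blast
    show "openin X V" if "V \<in> \<B>" for V using that unfolding \<B>_def X by auto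
    fix U x assume U: "openin X U \<and> x \<in> U"
    then obtain r where r: "r > 0" "mball x r \<subseteq> U" and x: "x \<in> M"
      unfolding X openin_mtopology by blast
    obtain n where n: "inverse (real (Suc n)) < r/2"
      using reals_Archimedean[of "r/2"] r by auto
    have "x \<in> mtopology closure_of C" "inverse (real (Suc n)) > 0" using C x by simp_all
    then obtain c where c: "c \<in> C" "c \<in> mball x (inverse (real (Suc n)))"
      unfolding metric_closure_of by blast
    have "mball c (inverse (real (Suc n))) \<subseteq> mball x r"
    proof
      fix z assume "z \<in> mball c (inverse (real (Suc n)))"
      then show "z \<in> mball x r"
        using c n triangle[of x c z] by auto
    qed
    moreover have "x \<in> mball c (inverse (real (Suc n)))" using c by (simp add: commute)
    ultimately show "\<exists>V\<in>\<B>. x \<in> V \<and> V \<subseteq> U"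
      using c r unfolding \<B>_def by (intro bexI[of _ "mball c (inverse (real (Suc n)))"]) auto
  qed
qed

lemma second_countable_prod_topology:
  assumes "second_countable X" "second_countable Y"
  shows "second_countable (prod_topology X Y)"
proof -
  obtain \<B> where \<B>: "countable \<B>" "\<And>V. V \<in> \<B> \<Longrightarrow> openin X V"
      "\<And>U x. openin X U \<Longrightarrow> x \<in> U \<Longrightarrow> \<exists>V\<in>\<B>. x \<in> V \<and> V \<subseteq> U"
    using assms(1) unfolding second_countable_def by metis
  obtain \<C> where \<C>: "countable \<C>" "\<And>V. V \<in> \<C> \<Longrightarrow> openin Y V"
      "\<And>U x. openin Y U \<Longrightarrow> x \<in> U \<Longrightarrow> \<exists>V\<in>\<C>. x \<in> V \<and> V \<subseteq> U"
    using assms(2) unfolding second_countable_def by metis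
  show ?thesis unfolding second_countable_def
  proof (intro exI[of _ "(\<lambda>(V, W). V \<times> W) ` (\<B> \<times> \<C>)"] conjI ballI allI impI)
    show "countable ((\<lambda>(V, W). V \<times> W) ` (\<B> \<times> \<C>))" using \<B> \<C> by blast
    show "openin (prod_topology X Y) V" if "V \<in> (\<lambda>(V, W). V \<times> W) ` (\<B> \<times> \<C>)" for V
      using that \<B>(2) \<C>(2) by (auto simp: openin_prod_Times_iff)
    fix O' p assume "openin (prod_topology X Y) O' \<and> p \<in> O'"
    then obtain U V where UV: "openin X U" "openin Y V" "fst p \<in> U" "snd p \<in> V" "U \<times> V \<subseteq> O'"
      unfolding openin_prod_topology_alt by (metis prod.collapse)
    then obtain U' V' where "U' \<in> \<B>" "V' \<in> \<C>" "fst p \<in> U'" "snd p \<in> V'" "U' \<subseteq> U" "V' \<subseteq> V"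
      using \<B>(3) \<C>(3) by metis
    then show "\<exists>V\<in>(\<lambda>(V, W). V \<times> W) ` (\<B> \<times> \<C>). p \<in> V \<and> V \<subseteq> O'"
      using UV by (intro bexI[of _ "U' \<times> V'"]) (auto simp: mem_Times_iff)
  qed
qed

lemma comeager_dense:
  assumes "completely_metrizable_space X" "meager_in X (topspace X - D)"
  shows "X closure_of D = topspace X"
proof -
  have "topspace X - X closure_of D \<subseteq> topspace X - D"
    using closure_of_subset_Int[of X D] by blast
  then have "meager_in X (topspace X - X closure_of D)"
    by (rule meager_in_mono[OF assms(2)])
  then have "topspace X - X closure_of D = {}"
    by (intro meager_in_open_imp_empty[OF assms(1)]) auto
  then show ?thesis using closure_of_subset_topspace[of X D] by blast
qed

lemma dense_gdelta_comeager:
  assumes "gdelta_in X C" "X closure_of C = topspace X"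
  shows "meager_in X (topspace X - C)"
proof -
  obtain \<U> where \<U>: "countable \<U>" "\<U> \<subseteq> Collect (openin X)" "\<Inter>\<U> = C"
    using assms(1) unfolding gdelta_in_alt intersection_of_def by auto
  have "meager_in X (\<Union>U\<in>\<U>. topspace X - U)"
  proof (intro meager_in_UN \<U>(1) meager_in_closed)
    fix U assume U: "U \<in> \<U>"
    then show "closedin X (topspace X - U)" using \<U>(2) by blast
    have "X closure_of C \<subseteq> X closure_of U" using U \<U>(3) by (intro closure_of_mono) blast
    then show "X interior_of (topspace X - U) = {}"
      using assms(2) by (auto simp: interior_of_complement)
  qed
  then show ?thesis by (rule meager_in_mono) (use \<U>(3) in blast)
qed

section \<open>The Baire property\<close>

definition baire_property :: "'a topology \<Rightarrow> 'a set \<Rightarrow> bool" where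
  "baire_property X A \<longleftrightarrow> (\<exists>U. openin X U \<and> meager_in X (A - U) \<and> meager_in X (U - A))"

lemma baire_property_UN:
  assumes "countable I" and "\<And>i. i \<in> I \<Longrightarrow> baire_property X (A i)"
  shows "baire_property X (\<Union>i\<in>I. A i)"
proof -
  obtain U where U: "\<And>i. i \<in> I \<Longrightarrow> openin X (U i) \<and> meager_in X (A i - U i) \<and> meager_in X (U i - A i)"
    using assms(2) unfolding baire_property_def by metis
  have m: "meager_in X (\<Union>i\<in>I. A i - U i)" "meager_in X (\<Union>i\<in>I. U i - A i)"
    using U assms(1) by (auto intro!: meager_in_UN)
  have "meager_in X ((\<Union>i\<in>I. A i) - (\<Union>i\<in>I. U i))"
    by (rule meager_in_mono[OF m(1)]) blast
  moreover have "meager_in X ((\<Union>i\<in>I. U i) - (\<Union>i\<in>I. A i))"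
    by (rule meager_in_mono[OF m(2)]) blast
  moreover have "openin X (\<Union>i\<in>I. U i)" using U by blast
  ultimately show ?thesis unfolding baire_property_def by blast
qed

lemma meager_in_frontier:
  assumes "closedin X K"
  shows "meager_in X (K - X interior_of K)"
proof (rule meager_in_closed)
  show "closedin X (K - X interior_of K)" using assms by auto
  have "X interior_of (K - X interior_of K) \<subseteq> X interior_of K"
    by (simp add: interior_of_mono)
  then show "X interior_of (K - X interior_of K) = {}"
    using interior_of_subset[of X "K - X interior_of K"] by blast
qed

text \<open>A closed set exceeds its interior only by a nowhere dense set, so closed approximations
  are as good as open ones. This is what yields closure under complements.\<close>

lemma baire_property_closedI:
  assumes "closedin X K" "meager_in X (A - K)" "meager_in X (K - A)"
  shows "baire_property X A"
  unfolding baire_property_def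
proof (intro exI[of _ "X interior_of K"] conjI)
  show "meager_in X (A - X interior_of K)"
    using meager_in_Un[OF meager_in_frontier[OF assms(1)] assms(2)] by (rule meager_in_mono) blast
  show "meager_in X (X interior_of K - A)"
    using assms(3) by (rule meager_in_mono) (use interior_of_subset in fast)
qed simp

lemma baire_property_closedin: "closedin X K \<Longrightarrow> baire_property X K"
  by (rule baire_property_closedI[of X K]) auto

lemma baire_property_Diff:
  assumes "baire_property X A"
  shows "baire_property X (topspace X - A)"
proof -
  obtain U where U: "openin X U" "meager_in X (A - U)" "meager_in X (U - A)"
    using assms unfolding baire_property_def by blast
  show ?thesis
  proof (rule baire_property_closedI)
    show "closedin X (topspace X - U)" using U by auto
    show "meager_in X (topspace X - A - (topspace X - U))"
      using U(3) by (rule meager_in_mono) blast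
    show "meager_in X (topspace X - U - (topspace X - A))"
      using U(2) by (rule meager_in_mono) blast
  qed
qed

lemma baire_property_closedE:
  assumes "baire_property X A" "A \<subseteq> topspace X"
  obtains K where "closedin X K" "meager_in X (A - K)" "meager_in X (K - A)"
proof -
  obtain U where U: "openin X U" "meager_in X (topspace X - A - U)" "meager_in X (U - (topspace X - A))"
    using baire_property_Diff[OF assms(1)] unfolding baire_property_def by blast
  show thesis
  proof
    show "closedin X (topspace X - U)" using U(1) by auto
    show "meager_in X (A - (topspace X - U))"
      using U(3) by (rule meager_in_mono) (use assms(2) in blast)
    show "meager_in X (topspace X - U - A)"
      using U(2) by (rule meager_in_mono) blast
  qed
qed

lemma baire_property_meager_modification:
  assumes "baire_property X A" "meager_in X (A - B)" "meager_in X (B - A)"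
  shows "baire_property X B"
proof -
  obtain U where U: "openin X U" "meager_in X (A - U)" "meager_in X (U - A)"
    using assms unfolding baire_property_def by blast
  have "meager_in X (B - U)"
    using meager_in_Un[OF assms(3) U(2)] by (rule meager_in_mono) blast
  moreover have "meager_in X (U - B)"
    using meager_in_Un[OF assms(2) U(3)] by (rule meager_in_mono) blast
  ultimately show ?thesis using U(1) unfolding baire_property_def by blast
qed

section \<open>The Baire property of projections\<close>

lemma baire_hull:
  assumes sc: "second_countable X" and A: "A \<subseteq> topspace X"
  obtains K where "closedin X K" "meager_in X (A - K)" "K \<subseteq> X closure_of A"
    "\<And>U. openin X U \<Longrightarrow> meager_in X (A \<inter> U) \<Longrightarrow> K \<inter> U = {}"
proof -
  obtain \<B> where \<B>: "countable \<B>" "\<And>V. V \<in> \<B> \<Longrightarrow> openin X V"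
      "\<And>U x. openin X U \<Longrightarrow> x \<in> U \<Longrightarrow> \<exists>V\<in>\<B>. x \<in> V \<and> V \<subseteq> U"
    using sc unfolding second_countable_def by metis
  \<comment> \<open>The hull is the complement of \<open>\<Union>\<V>\<close>. It misses only
    countably many meager pieces of \<open>A\<close>, and an open set in which \<open>A\<close> is
    meager is a union of members of \<open>\<V>\<close>, hence disjoint from the hull.\<close>
  define \<V> where "\<V> = {V \<in> \<B>. meager_in X (A \<inter> V)}"
  have *: "(topspace X - \<Union>\<V>) \<inter> U = {}" if U: "openin X U" "meager_in X (A \<inter> U)" for U
  proof -
    have "x \<in> \<Union>\<V>" if "x \<in> U" for x
    proof -
      obtain V where V: "V \<in> \<B>" "x \<in> V" "V \<subseteq> U" using \<B>(3) U(1) \<open>x \<in> U\<close> by blast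
      have "meager_in X (A \<inter> V)" using U(2) by (rule meager_in_mono) (use V in blast)
      then show ?thesis unfolding \<V>_def using V by blast
    qed
    then show ?thesis by blast
  qed
  show ?thesis
  proof
    show "closedin X (topspace X - \<Union>\<V>)" using \<B>(2) unfolding \<V>_def by auto
    have "meager_in X (\<Union>V\<in>\<V>. A \<inter> V)"
      using \<B>(1) unfolding \<V>_def by (intro meager_in_UN) auto
    then show "meager_in X (A - (topspace X - \<Union>\<V>))"
      by (rule meager_in_mono) (use A in blast)
    \<comment> \<open>On the open complement of its closure \<open>A\<close> is empty, so the
      minimality \<open>*\<close> keeps the hull inside the closure.\<close>
    have "A \<inter> (topspace X - X closure_of A) = {}"
      using closure_of_subset_Int[of X A] by blast
    then have "(topspace X - \<Union>\<V>) \<inter> (topspace X - X closure_of A) = {}"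
      by (intro *) auto
    then show "topspace X - \<Union>\<V> \<subseteq> X closure_of A" by blast
  qed (rule *)
qed

text \<open>A form of Nikodym's theorem on the Souslin operation. Each hull \<open>K s\<close> lies
  in the union of the hulls of its children up to a meager set. Off these countably many errors a
  point of \<open>K []\<close> can be followed along a branch, all of whose closures contain it, and
  \<open>branch\<close> returns it to \<open>A []\<close>. So \<open>A []\<close> equals the closed
  set \<open>K []\<close> up to a meager set. The comeager \<open>P\<close> allows
  \<open>branch\<close> to be checked only at generic points.\<close>

lemma souslin_baire_property:
  fixes A :: "nat list \<Rightarrow> 'a set"
  assumes sc: "second_countable X" and P: "meager_in X (topspace X - P)"
    and sub: "\<And>s. A s \<subseteq> topspace X"
    and split: "\<And>s. A s \<subseteq> (\<Union>n. A (s @ [n]))"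
    and branch: "\<And>\<alpha> x. x \<in> P \<Longrightarrow> (\<And>n. x \<in> X closure_of A (map \<alpha> [0..<n])) \<Longrightarrow> x \<in> A []"
  shows "baire_property X (A [])"
proof -
  have "\<exists>K. closedin X K \<and> meager_in X (A s - K) \<and> K \<subseteq> X closure_of A s \<and>
      (\<forall>U. openin X U \<longrightarrow> meager_in X (A s \<inter> U) \<longrightarrow> K \<inter> U = {})" for s
    using baire_hull[OF sc sub[of s]] by metis
  then obtain K where K: "\<And>s. closedin X (K s)" "\<And>s. meager_in X (A s - K s)"
      "\<And>s. K s \<subseteq> X closure_of A s"
      "\<And>s U. openin X U \<Longrightarrow> meager_in X (A s \<inter> U) \<Longrightarrow> K s \<inter> U = {}"
    by metis
  define M where "M s = K s - (\<Union>n. K (s @ [n]))" for s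
  have M: "meager_in X (M s)" for s
  proof -
    \<comment> \<open>The union of the children's hulls is only an F-sigma set, so it is replaced by
      a closed \<open>L\<close> equal to it modulo a meager set. As \<open>A s\<close> is meager off
      \<open>L\<close>, minimality puts \<open>K s\<close> inside \<open>L\<close>.\<close>
    have "baire_property X (\<Union>n. K (s @ [n]))"
      using K(1) by (intro baire_property_UN baire_property_closedin) auto
    moreover have "(\<Union>n. K (s @ [n])) \<subseteq> topspace X" using K(1) closedin_subset by blast
    ultimately obtain L where L: "closedin X L" "meager_in X ((\<Union>n. K (s @ [n])) - L)"
        "meager_in X (L - (\<Union>n. K (s @ [n])))"
      by (rule baire_property_closedE)
    have "meager_in X (A s \<inter> (topspace X - L))"
    proof (rule meager_in_mono)
      show "meager_in X ((\<Union>n. A (s @ [n]) - K (s @ [n])) \<union> ((\<Union>n. K (s @ [n])) - L))"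
        using K(2) L(2) by (intro meager_in_Un meager_in_UN) auto
      show "A s \<inter> (topspace X - L) \<subseteq> (\<Union>n. A (s @ [n]) - K (s @ [n])) \<union> ((\<Union>n. K (s @ [n])) - L)"
        using split[of s] by blast
    qed
    then have "K s \<inter> (topspace X - L) = {}"
      using L(1) K(4) by blast
    then have "M s \<subseteq> L - (\<Union>n. K (s @ [n]))"
      unfolding M_def using closedin_subset[OF K(1)[of s]] by blast
    then show ?thesis using L(3) meager_in_mono by blast
  qed
  \<comment> \<open>Off the sets \<open>M s\<close>, membership in \<open>K []\<close> propagates along a branch.\<close>
  have "K [] - A [] \<subseteq> (topspace X - P) \<union> (\<Union>s. M s)"
  proof (rule subsetI, rule ccontr)
    fix x assume x: "x \<in> K [] - A []" and "x \<notin> (topspace X - P) \<union> (\<Union>s. M s)"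
    then have xP: "x \<in> P" and xM: "x \<notin> M s" for s
      using closedin_subset[OF K(1)[of "[]"]] by auto
    have "\<exists>t. \<forall>n. (length (t n) = n \<and> x \<in> K (t n)) \<and> (\<exists>m. t (Suc n) = t n @ [m])"
    proof (rule dependent_nat_choice)
      show "\<exists>t. length t = 0 \<and> x \<in> K t" using x by auto
      fix t n assume t: "length t = n \<and> x \<in> K t"
      then obtain m where "x \<in> K (t @ [m])" using xM[of t] unfolding M_def by blast
      then show "\<exists>u. (length u = Suc n \<and> x \<in> K u) \<and> (\<exists>m. u = t @ [m])"
        using t by (intro exI[of _ "t @ [m]"]) auto
    qed
    then obtain t where t: "\<And>n. length (t n) = n" "\<And>n. x \<in> K (t n)" "\<And>n. \<exists>m. t (Suc n) = t n @ [m]"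
      by auto
    then obtain \<alpha> where \<alpha>: "\<And>n. t (Suc n) = t n @ [\<alpha> n]" by metis
    have "t n = map \<alpha> [0..<n]" for n
      by (induction n) (use t(1)[of 0] \<alpha> in auto)
    then have "x \<in> X closure_of A (map \<alpha> [0..<n])" for n
      using t(2)[of n] K(3) by auto
    from branch[OF xP this] x show False by blast
  qed
  moreover have "meager_in X ((topspace X - P) \<union> (\<Union>s. M s))"
    using P M by (intro meager_in_Un meager_in_UN) auto
  ultimately have "meager_in X (K [] - A [])" by (metis meager_in_mono)
  then show ?thesis using baire_property_closedI K(1,2) by blast
qed

text \<open>The Souslin scheme approximates the second coordinate by a dense sequence:
  \<open>A s\<close> is the projection of the part of \<open>R\<close> whose second coordinate is
  close to the points coded by \<open>s\<close>. Along a branch completeness provides a limit, and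
  closedness of \<open>R\<close> makes it a witness. The closedness is only relative to
  \<open>P\<close>, which is why generic points suffice in
  \<open>souslin_baire_property\<close>.\<close>

lemma (in Metric_space) baire_property_projection:
  assumes sc: "second_countable X" and P: "P \<subseteq> topspace X" "meager_in X (topspace X - P)"
    and compl: mcomplete and sep: "separable_space mtopology"
    and R: "closedin (prod_topology (subtopology X P) mtopology) R"
  shows "baire_property X (fst ` R)"
proof (cases "M = {}")
  \<comment> \<open>Split off because the dense set is enumerated as a sequence below.\<close>
  case True
  then have "R = {}" using closedin_subset[OF R] topspace_mtopology by auto
  moreover have "baire_property X {}" by (rule baire_property_closedin) simp
  ultimately show ?thesis by simp
next
  case False
  obtain C where C: "countable C" "C \<subseteq> M" "mtopology closure_of C = M"
    using sep unfolding separable_space_def by auto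
  have "C \<noteq> {}" using C(3) False by auto
  then obtain q :: "nat \<Rightarrow> 'a" where q: "range q = C"
    using C(1) by (metis uncountable_def)
  have qM: "q n \<in> M" for n using q C(2) by blast
  have near: "\<exists>n. d w (q n) \<le> r" if "w \<in> M" "r > 0" for w r
  proof -
    have "w \<in> mtopology closure_of C" using that C by simp
    then have "\<exists>c\<in>C. c \<in> mball w r" unfolding metric_closure_of using that(2) by blast
    then show ?thesis using q by (metis in_mball less_imp_le rangeE)
  qed
  \<comment> \<open>The radii shrink with the position in \<open>s\<close>, so that the sets
    \<open>W\<close> along a branch have diameters tending to 0.\<close>
  define W where "W s = {w \<in> M. \<forall>i<length s. d w (q (s ! i)) \<le> (1/2)^i}" for s :: "nat list"
  define A where "A s = {p. \<exists>w\<in>W s. (p, w) \<in> R}" for s :: "nat list"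
  have RPM: "p \<in> P \<and> p \<in> topspace X \<and> w \<in> M" if "(p, w) \<in> R" for p w
    using closedin_subset[OF R] that by auto
  have "baire_property X (A [])"
  proof (rule souslin_baire_property[OF sc P(2)])
    show "A s \<subseteq> topspace X" for s using RPM unfolding A_def by blast
    show "A s \<subseteq> (\<Union>n. A (s @ [n]))" for s
    proof
      fix p assume "p \<in> A s"
      then obtain w where w: "w \<in> W s" "(p, w) \<in> R" unfolding A_def by blast
      then obtain n where n: "d w (q n) \<le> (1/2)^length s"
        using near[of w "(1/2)^length s"] RPM by auto
      then have "w \<in> W (s @ [n])"
        using w(1) unfolding W_def by (auto simp: nth_append less_Suc_eq)
      then show "p \<in> (\<Union>n. A (s @ [n]))" using w(2) unfolding A_def by blast
    qed
    fix \<alpha> p assume p: "p \<in> P" and cl: "\<And>n. p \<in> X closure_of A (map \<alpha> [0..<n])"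
    let ?W = "\<lambda>n. W (map \<alpha> [0..<n])"
    \<comment> \<open>These witnesses need not be related to \<open>p\<close>. They only locate the
      region where the witnesses of points close to \<open>p\<close> must lie.\<close>
    have "\<exists>w. w \<in> ?W n" for n
    proof -
      have "A (map \<alpha> [0..<n]) \<noteq> {}" using cl[of n] by auto
      then show ?thesis unfolding A_def by blast
    qed
    then obtain u where u: "\<And>n. u n \<in> ?W n" by metis
    have uM: "u n \<in> M" for n using u[of n] unfolding W_def by blast
    have Wq: "d w (q (\<alpha> i)) \<le> (1/2)^i" if "w \<in> ?W n" "i < n" for w n i
      using that unfolding W_def by force
    have Wd: "d v w \<le> 2 * (1/2)^i" if "v \<in> ?W n" "w \<in> ?W m" "i < n" "i < m" for v w n m i
    proof -
      have vw: "v \<in> M" "w \<in> M" using that unfolding W_def by auto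
      show ?thesis
        using Wq[OF that(1,3)] Wq[OF that(2,4)] triangle[OF vw(1) qM[of "\<alpha> i"] vw(2)]
          commute[of w "q (\<alpha> i)"] by linarith
    qed
    have small: "\<exists>i. 2 * (1/2)^i < e" if "e > 0" for e :: real
      using real_arch_pow_inv[of "e/2" "1/2"] that by (auto simp: mult.commute)
    have "MCauchy u"
      unfolding MCauchy_def
    proof (intro conjI allI impI)
      show "range u \<subseteq> M" using uM by blast
      fix e :: real assume "e > 0"
      then obtain i where i: "2 * (1/2)^i < e" using small by blast
      show "\<exists>N. \<forall>n n'. N \<le> n \<longrightarrow> N \<le> n' \<longrightarrow> d (u n) (u n') < e"
        using Wd[OF u u, of i] i by (intro exI[of _ "Suc i"]) (force simp: Suc_le_eq)
    qed
    then obtain w where w: "limitin mtopology u w sequentially"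
      using compl unfolding mcomplete_def by blast
    then have wM: "w \<in> M" using limitin_mspace by blast
    have "(p, w) \<in> R"
    proof (rule ccontr)
      assume "(p, w) \<notin> R"
      let ?P = "prod_topology (subtopology X P) mtopology"
      have "openin ?P (topspace ?P - R)" using R by blast
      moreover have "(p, w) \<in> topspace ?P - R" using \<open>(p, w) \<notin> R\<close> p P(1) wM by auto
      ultimately obtain O1 O2 where O: "openin (subtopology X P) O1" "openin mtopology O2" "p \<in> O1" "w \<in> O2"
          "O1 \<times> O2 \<subseteq> topspace ?P - R"
        unfolding openin_prod_topology_alt by meson
      \<comment> \<open>The closures are taken in \<open>X\<close> while \<open>O1\<close> is only
        relatively open in \<open>P\<close>. The extension \<open>O1'\<close> catches a point
        \<open>p'\<close> of \<open>A\<close>, which lies in \<open>P\<close> and so again in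
        \<open>O1\<close>.\<close>
      then obtain O1' where O1': "openin X O1'" "O1 = O1' \<inter> P" unfolding openin_subtopology by auto
      obtain e where e: "e > 0" "mball w e \<subseteq> O2" using O(2,4) unfolding openin_mtopology by blast
      obtain i where i: "2 * (1/2)^i < e/2" using small[of "e/2"] e by auto
      obtain N where N: "\<And>n. n \<ge> N \<Longrightarrow> d (u n) w < e/2"
        using w e(1) unfolding limit_metric_sequentially by (metis half_gt_zero)
      let ?n = "max N (Suc i)"
      have "v \<in> mball w e" if "v \<in> ?W ?n" for v
      proof -
        have "v \<in> M" using that unfolding W_def by auto
        have "d v (u ?n) \<le> 2 * (1/2)^i" by (rule Wd[OF that u]) auto
        then show ?thesis
          using \<open>v \<in> M\<close> N[of ?n] i triangle[OF \<open>v \<in> M\<close> uM[of ?n] wM] wM commute[of v w]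
          by auto
      qed
      moreover obtain p' where p': "p' \<in> A (map \<alpha> [0..<?n])" "p' \<in> O1'"
        using cl[of ?n] O1' O(3) unfolding in_closure_of by blast
      then obtain v where v: "v \<in> ?W ?n" "(p', v) \<in> R" unfolding A_def by blast
      ultimately have "(p', v) \<in> O1 \<times> O2" using O1' e(2) p'(2) RPM by blast
      then show False using O(5) v(2) by blast
    qed
    then show "p \<in> A []" unfolding A_def W_def using wM by auto
  qed
  moreover have "A [] = fst ` R" unfolding A_def W_def using RPM by (force simp: image_iff)
  ultimately show ?thesis by simp
qed

section \<open>Borel maps are continuous on a comeager set\<close>

lemma borel_measurable_continuous_on_comeager:
  assumes C0: "C0 \<subseteq> topspace X" "meager_in X (topspace X - C0)"
    and sc: "second_countable Y"
    and f: "f \<in> measurable (borel_of (subtopology X C0)) (borel_of Y)"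
  obtains C where "C \<subseteq> C0" "meager_in X (topspace X - C)" "continuous_map (subtopology X C) Y f"
proof -
  let ?X = "subtopology X C0"
  have sp: "topspace ?X = C0" using C0 by auto
  have bor: "sets (borel_of Z) = sigma_sets (topspace Z) {U. openin Z U}"
    "space (borel_of Z) = topspace Z" for Z :: "'z topology"
    unfolding borel_of_def by (auto intro!: sets_measure_of space_measure_of dest: openin_subset)
  have bp: "baire_property X B" if "B \<in> sigma_sets C0 {U. openin ?X U}" for B
    using that
  proof (induction rule: sigma_sets.induct)
    case (Basic a)
    then obtain U where U: "openin X U" "a = U \<inter> C0" unfolding openin_subtopology by auto
    show ?case unfolding baire_property_def
    proof (intro exI[of _ U] conjI)
      show "meager_in X (a - U)" using U by (auto intro: meager_in_mono[OF meager_in_empty])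
      show "meager_in X (U - a)" using C0(2)
        by (rule meager_in_mono) (use U openin_subset in blast)
    qed (use U in simp)
  next
    case Empty show ?case by (rule baire_property_closedin) simp
  next
    \<comment> \<open>The complement is taken in \<open>C0\<close>; it differs from the complement
      in \<open>X\<close> by a meager set.\<close>
    case (Compl a)
    show ?case
      by (rule baire_property_meager_modification[OF baire_property_Diff[OF Compl.IH]])
        (rule meager_in_mono[OF C0(2)], use C0(1) in blast)+
  next
    case (Union a) then show ?case by (intro baire_property_UN) auto
  qed
  obtain \<B> where \<B>: "countable \<B>" "\<And>V. V \<in> \<B> \<Longrightarrow> openin Y V"
      "\<And>U x. openin Y U \<Longrightarrow> x \<in> U \<Longrightarrow> \<exists>V\<in>\<B>. x \<in> V \<and> V \<subseteq> U"
    using sc unfolding second_countable_def by metis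
  have fY: "f x \<in> topspace Y" if "x \<in> C0" for x
    using measurable_space[OF f, of x] that C0(1) by (auto simp: bor)
  have "baire_property X {x \<in> C0. f x \<in> V}" if "V \<in> \<B>" for V
  proof -
    have "V \<in> sets (borel_of Y)" using \<B>(2)[OF that] by (auto simp: bor intro: sigma_sets.Basic)
    from measurable_sets[OF f this] have "f -` V \<inter> C0 \<in> sigma_sets C0 {U. openin ?X U}"
      using sp by (simp add: bor)
    moreover have "f -` V \<inter> C0 = {x \<in> C0. f x \<in> V}" by auto
    ultimately show ?thesis using bp by simp
  qed
  then have "\<forall>V\<in>\<B>. \<exists>U. openin X U \<and>
      meager_in X ({x \<in> C0. f x \<in> V} - U) \<and> meager_in X (U - {x \<in> C0. f x \<in> V})"
    unfolding baire_property_def by blast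
  from bchoice[OF this] obtain U where U: "\<And>V. V \<in> \<B> \<Longrightarrow> openin X (U V) \<and>
      meager_in X ({x \<in> C0. f x \<in> V} - U V) \<and> meager_in X (U V - {x \<in> C0. f x \<in> V})"
    by blast
  \<comment> \<open>Off \<open>N\<close> the preimage of each basic open \<open>V\<close> coincides
    with the open set \<open>U V\<close>, which is continuity of the restriction.\<close>
  define N where "N = (\<Union>V\<in>\<B>. ({x \<in> C0. f x \<in> V} - U V) \<union> (U V - {x \<in> C0. f x \<in> V}))"
  have N: "meager_in X N" unfolding N_def
    using U \<B>(1) by (intro meager_in_UN meager_in_Un) auto
  show thesis
  proof
    show "C0 - N \<subseteq> C0" by blast
    show "meager_in X (topspace X - (C0 - N))"
      using meager_in_Un[OF C0(2) N] by (rule meager_in_mono) blast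
    show "continuous_map (subtopology X (C0 - N)) Y f"
      unfolding continuous_map_def
    proof (intro conjI allI impI)
      show "f \<in> topspace (subtopology X (C0 - N)) \<rightarrow> topspace Y" using fY by auto
      fix O' assume O': "openin Y O'"
      have "{x \<in> topspace (subtopology X (C0 - N)). f x \<in> O'} = (\<Union>V\<in>{V \<in> \<B>. V \<subseteq> O'}. U V) \<inter> (C0 - N)"
        (is "?l = ?r")
      proof
        show "?l \<subseteq> ?r"
        proof
          fix x assume x: "x \<in> ?l"
          then obtain V where "V \<in> \<B>" "f x \<in> V" "V \<subseteq> O'" using \<B>(3)[OF O', of "f x"] by auto
          then show "x \<in> ?r" using x unfolding N_def by auto
        qed
        show "?r \<subseteq> ?l"
        proof
          fix x assume "x \<in> ?r"
          then obtain V where V: "V \<in> \<B>" "V \<subseteq> O'" "x \<in> U V" "x \<in> C0" "x \<notin> N" by auto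
          then have "f x \<in> V" unfolding N_def by auto
          then show "x \<in> ?l" using V C0 by auto
        qed
      qed
      moreover have "openin X (\<Union>V\<in>{V \<in> \<B>. V \<subseteq> O'}. U V)" using U by blast
      ultimately show "openin (subtopology X (C0 - N)) {x \<in> topspace (subtopology X (C0 - N)). f x \<in> O'}"
        by (simp only: openin_subtopology_Int)
    qed
  qed
qed

section \<open>Polish group actions\<close>

locale polish_action =
  fixes G (structure) and T :: "'g topology" and X :: "'x topology" and \<phi> :: "'g \<Rightarrow> 'x \<Rightarrow> 'x"
  assumes polish_group: "polish_group G T" and polish_G_space: "polish_G_space G T X \<phi>"
begin

sublocale group G using polish_group by (simp add: polish_group_def)

sublocale group_action G "topspace X" \<phi> using polish_G_space by (simp add: polish_G_space_def)

lemma topspace_group [simp]: "topspace T = carrier G"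
  using polish_group by (simp add: polish_group_def)

lemma completely_metrizable_group: "completely_metrizable_space T"
  and completely_metrizable_space: "completely_metrizable_space X"
  and completely_metrizable_prod: "completely_metrizable_space (prod_topology T X)"
  using polish_group polish_G_space
  by (auto simp: polish_group_def polish_G_space_def polish_topology_def completely_metrizable_space_prod_topology)

lemma second_countable_group: "second_countable T"
  and second_countable_space: "second_countable X"
  using polish_group polish_G_space
  by (auto simp: polish_group_def polish_G_space_def polish_topology_def
      intro: metrizable_separable_imp_second_countable completely_metrizable_imp_metrizable_space)

lemma second_countable_prod: "second_countable (prod_topology T X)"
  by (intro second_countable_prod_topology second_countable_group second_countable_space)

lemma Hausdorff_X: "Hausdorff_space X"
  using completely_metrizable_space
  by (simp add: completely_metrizable_imp_metrizable_space metrizable_imp_Hausdorff_space)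

lemma act_one [simp]: "x \<in> topspace X \<Longrightarrow> \<phi> \<one> x = x"
  using id_eq_one by (metis restrict_apply')

lemma act_inv [simp]:
  assumes "g \<in> carrier G" "x \<in> topspace X"
  shows "\<phi> (inv g) (\<phi> g x) = x" "\<phi> g (\<phi> (inv g) x) = x"
  using composition_rule[of x "inv g" g] composition_rule[of x g "inv g"] assms by auto

lemma act_closed [simp]: "g \<in> carrier G \<Longrightarrow> x \<in> topspace X \<Longrightarrow> \<phi> g x \<in> topspace X"
  using element_image by blast

lemma act_act: "g \<in> carrier G \<Longrightarrow> h \<in> carrier G \<Longrightarrow> x \<in> topspace X \<Longrightarrow> \<phi> g (\<phi> h x) = \<phi> (g \<otimes> h) x"
  using composition_rule by simp

lemma continuous_map_act:
  assumes "continuous_map Z T a" "continuous_map Z X b"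
  shows "continuous_map Z X (\<lambda>z. \<phi> (a z) (b z))"
proof -
  have "continuous_map (prod_topology T X) X (\<lambda>(g, x). \<phi> g x)"
    using polish_G_space by (simp add: polish_G_space_def)
  from continuous_map_compose[OF continuous_map_pairedI[OF assms] this]
  show ?thesis by (simp add: o_def)
qed

lemma continuous_map_mult:
  assumes "continuous_map Z T a" "continuous_map Z T b"
  shows "continuous_map Z T (\<lambda>z. a z \<otimes> b z)"
proof -
  have "continuous_map (prod_topology T T) T (\<lambda>(g, x). g \<otimes> x)"
    using polish_group by (simp add: polish_group_def)
  from continuous_map_compose[OF continuous_map_pairedI[OF assms] this]
  show ?thesis by (simp add: o_def)
qed

lemma continuous_map_minv:
  assumes "continuous_map Z T a"
  shows "continuous_map Z T (\<lambda>z. inv a z)"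
proof -
  have "continuous_map T T (\<lambda>g. inv g)"
    using polish_group by (simp add: polish_group_def)
  from continuous_map_compose[OF assms this] show ?thesis by (simp add: o_def)
qed

lemma homeomorphic_map_act:
  assumes "g \<in> carrier G" shows "homeomorphic_map X X (\<phi> g)"
proof -
  have "homeomorphic_maps X X (\<phi> g) (\<phi> (inv g))"
    unfolding homeomorphic_maps_def
    using assms by (auto intro!: continuous_map_act[where a = "\<lambda>_. g"] continuous_map_act[where a = "\<lambda>_. inv g"])
  then show ?thesis using homeomorphic_map_maps by blast
qed

lemma homeomorphic_map_right_translation:
  assumes "h \<in> carrier G" shows "homeomorphic_map T T (\<lambda>g. g \<otimes> h)"
proof -
  have "homeomorphic_maps T T (\<lambda>g. g \<otimes> h) (\<lambda>g. g \<otimes> inv h)"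
    unfolding homeomorphic_maps_def
    using assms by (auto intro!: continuous_map_mult simp: m_assoc)
  then show ?thesis using homeomorphic_map_maps by blast
qed

text \<open>Pulling \<open>topspace T \<times> B\<close> back along this map gives the pairs
  \<open>(g, z)\<close> with \<open>\<phi> g z\<close> in \<open>B\<close>; for meager
  \<open>B\<close> these pairs are therefore meager too.\<close>

lemma homeomorphic_map_graph:
  "homeomorphic_map (prod_topology T X) (prod_topology T X) (\<lambda>(g, z). (g, \<phi> g z))"
proof -
  have "homeomorphic_maps (prod_topology T X) (prod_topology T X) (\<lambda>(g, z). (g, \<phi> g z)) (\<lambda>(g, z). (g, \<phi> (inv g) z))"
    unfolding homeomorphic_maps_def case_prod_beta
    by (auto intro!: continuous_map_pairedI continuous_map_act continuous_map_minv
        continuous_map_fst continuous_map_snd)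
  then show ?thesis using homeomorphic_map_maps by blast
qed

text \<open>The change of variables that writes \<open>\<phi> g z\<close> as the image of
  \<open>\<phi> (inv h) z\<close> under \<open>g \<otimes> h\<close>; it transports meagerness from
  pairs near \<open>h\<close> to pairs near the identity.\<close>

lemma homeomorphic_map_shift:
  assumes h: "h \<in> carrier G"
  shows "homeomorphic_map (prod_topology T X) (prod_topology T X) (\<lambda>(g, z). (g \<otimes> h, \<phi> (inv h) z))"
proof -
  have "homeomorphic_maps (prod_topology T X) (prod_topology T X) (\<lambda>(g, z). (g \<otimes> h, \<phi> (inv h) z))
      (\<lambda>(g, z). (g \<otimes> inv h, \<phi> h z))"
    unfolding homeomorphic_maps_def case_prod_beta using h
    by (auto intro!: continuous_map_pairedI continuous_map_act continuous_map_mult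
        continuous_map_fst continuous_map_snd simp: m_assoc)
  then show ?thesis using homeomorphic_map_maps by blast
qed

section \<open>The Vaught transform of a comeager set\<close>

lemma invariant_dense_gdelta_Vaught:
  assumes "meager_in X (topspace X - C)"
  obtains D where "invariant_dense_gdelta G X \<phi> D"
    "\<And>z. z \<in> D \<Longrightarrow> meager_in T {g \<in> carrier G. \<phi> g z \<notin> C}"
proof -
  obtain \<F> where \<F>: "countable \<F>" "topspace X - C \<subseteq> \<Union>\<F>"
      "\<And>F. F \<in> \<F> \<Longrightarrow> closedin X F \<and> X interior_of F = {}"
    using assms unfolding meager_in_def by blast
  obtain \<B> where \<B>: "countable \<B>" "\<And>V. V \<in> \<B> \<Longrightarrow> openin T V"
      "\<And>U x. openin T U \<Longrightarrow> x \<in> U \<Longrightarrow> \<exists>V\<in>\<B>. x \<in> V \<and> V \<subseteq> U"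
    using second_countable_group unfolding second_countable_def by metis
  define S where "S F V = {z \<in> topspace X. \<exists>g\<in>V. \<phi> g z \<notin> F}" for F V
  \<comment> \<open>Membership says that for each \<open>F\<close> the closed set of
    \<open>g\<close> with \<open>\<phi> g z \<in> F\<close> has empty interior. Ranging over all
    open \<open>V\<close>, not only basic ones, makes invariance a matter of translating
    \<open>V\<close>.\<close>
  define D where "D = {z \<in> topspace X. \<forall>F\<in>\<F>. \<forall>V. openin T V \<and> V \<noteq> {} \<longrightarrow> z \<in> S F V}"
  let ?I = "\<F> \<times> (\<B> - {{}})"
  have VG: "V \<subseteq> carrier G" if "openin T V" for V using openin_subset[OF that] by simp
  have S_open: "openin X (S F V)" if F: "F \<in> \<F>" and V: "openin T V" for F V
  proof -
    have "openin X {z \<in> topspace X. \<phi> g z \<in> topspace X - F}" if "g \<in> V" for g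
    proof (rule openin_continuous_map_preimage)
      show "continuous_map X X (\<phi> g)"
        using homeomorphic_map_act homeomorphic_imp_continuous_map VG[OF V] that by blast
    qed (use \<F>(3)[OF F] in blast)
    moreover have "S F V = (\<Union>g\<in>V. {z \<in> topspace X. \<phi> g z \<in> topspace X - F})"
      unfolding S_def using VG[OF V] act_closed by blast
    ultimately show ?thesis by auto
  qed
  \<comment> \<open>Restricting \<open>V\<close> to the basis leaves a countable intersection of
    open sets.\<close>
  have D_eq: "D = topspace X \<inter> (\<Inter>(F, V)\<in>?I. S F V)"
  proof
    show "D \<subseteq> topspace X \<inter> (\<Inter>(F, V)\<in>?I. S F V)" unfolding D_def using \<B>(2) by auto
    show "topspace X \<inter> (\<Inter>(F, V)\<in>?I. S F V) \<subseteq> D"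
    proof
      fix z assume z: "z \<in> topspace X \<inter> (\<Inter>(F, V)\<in>?I. S F V)"
      have "z \<in> S F V" if F: "F \<in> \<F>" and V: "openin T V" "V \<noteq> {}" for F V
      proof -
        obtain W where W: "W \<in> \<B>" "W \<noteq> {}" "W \<subseteq> V" using \<B>(3)[OF V(1)] V(2) by blast
        then have "z \<in> S F W" using z F by blast
        then show ?thesis using W(3) unfolding S_def by blast
      qed
      then show "z \<in> D" using z unfolding D_def by blast
    qed
  qed
  show thesis
  proof
    show "invariant_dense_gdelta G X \<phi> D"
      unfolding invariant_dense_gdelta_def
    proof (intro conjI ballI)
      \<comment> \<open>Inserting the whole space keeps the intersected family nonempty.\<close>
      have "gdelta_in X (\<Inter>(insert (topspace X) ((\<lambda>(F, V). S F V) ` ?I)))"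
        using \<F>(1) \<B>(1) S_open \<B>(2) by (intro gdelta_in_Inter) (auto intro!: open_imp_gdelta_in)
      then show "gdelta_in X D" unfolding D_eq by simp
      have "meager_in X (\<Union>(F, V)\<in>?I. topspace X - S F V)"
      proof (intro meager_in_UN)
        show "countable ?I" using \<F>(1) \<B>(1) by auto
        fix i assume "i \<in> ?I"
        then obtain F V where i: "i = (F, V)" "F \<in> \<F>" "V \<in> \<B>" "V \<noteq> {}" by blast
        then obtain g where g: "g \<in> V" "g \<in> carrier G" using VG \<B>(2) by blast
        have "meager_in X {z \<in> topspace X. \<phi> g z \<in> F}"
          using meager_in_homeomorphic_vimage[OF homeomorphic_map_act[OF g(2)]] meager_in_closed \<F>(3)[OF i(2)]
          by blast
        then have "meager_in X (topspace X - S F V)"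
          by (rule meager_in_mono) (use g(1) in \<open>auto simp: S_def\<close>)
        then show "meager_in X (case i of (F, V) \<Rightarrow> topspace X - S F V)" using i by simp
      qed
      then have "meager_in X (topspace X - D)"
        by (rule meager_in_mono) (auto simp: D_eq)
      then show "X closure_of D = topspace X"
        by (rule comeager_dense[OF completely_metrizable_space])
      fix h z assume h: "h \<in> carrier G" and z: "z \<in> D"
      have zX: "z \<in> topspace X" using z unfolding D_def by blast
      have "\<phi> h z \<in> S F V" if F: "F \<in> \<F>" and V: "openin T V" "V \<noteq> {}" for F V
      proof -
        \<comment> \<open>An element of \<open>V\<close> moves \<open>\<phi> h z\<close> out of
          \<open>F\<close> exactly when its right translate by \<open>h\<close> moves
          \<open>z\<close> out of \<open>F\<close>.\<close>
        have "openin T ((\<lambda>g. g \<otimes> h) ` V)"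
          using homeomorphic_map_openness_eq[OF homeomorphic_map_right_translation[OF h]] V(1) by blast
        then have "z \<in> S F ((\<lambda>g. g \<otimes> h) ` V)" using z F V(2) unfolding D_def by blast
        then obtain g where g: "g \<in> V" "\<phi> (g \<otimes> h) z \<notin> F" unfolding S_def by blast
        then have "\<phi> g (\<phi> h z) \<notin> F" using VG[OF V(1)] h zX act_act[of g h z] by auto
        then show ?thesis unfolding S_def using g(1) h zX by auto
      qed
      then show "\<phi> h z \<in> D" unfolding D_def using h zX by auto
    qed
    fix z assume z: "z \<in> D"
    have zX: "z \<in> topspace X" using z unfolding D_def by blast
    have "meager_in T (\<Union>F\<in>\<F>. {g \<in> topspace T. \<phi> g z \<in> F})"
    proof (intro meager_in_UN \<F>(1) meager_in_closed)
      fix F assume F: "F \<in> \<F>"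
      have "continuous_map T X (\<lambda>g. \<phi> g z)"
        using zX by (auto intro!: continuous_map_act)
      then show "closedin T {g \<in> topspace T. \<phi> g z \<in> F}"
        by (rule closedin_continuous_map_preimage) (use \<F>(3)[OF F] in simp)
      show "T interior_of {g \<in> topspace T. \<phi> g z \<in> F} = {}"
      proof (rule ccontr)
        assume "T interior_of {g \<in> topspace T. \<phi> g z \<in> F} \<noteq> {}"
        then have "z \<in> S F (T interior_of {g \<in> topspace T. \<phi> g z \<in> F})"
          using z F unfolding D_def by auto
        then show False
          using interior_of_subset[of T "{g \<in> topspace T. \<phi> g z \<in> F}"] unfolding S_def by blast
      qed
    qed
    then show "meager_in T {g \<in> carrier G. \<phi> g z \<notin> C}"
    proof (rule meager_in_mono)
      show "{g \<in> carrier G. \<phi> g z \<notin> C} \<subseteq> (\<Union>F\<in>\<F>. {g \<in> topspace T. \<phi> g z \<in> F})"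
      proof
        fix g assume "g \<in> {g \<in> carrier G. \<phi> g z \<notin> C}"
        then have "g \<in> carrier G" "\<phi> g z \<in> topspace X - C" using zX by auto
        then show "g \<in> (\<Union>F\<in>\<F>. {g \<in> topspace T. \<phi> g z \<in> F})" using \<F>(2) by auto
      qed
    qed
  qed
qed

end

section \<open>Generic continuity of homomorphisms into actions of CLI groups\<close>

text \<open>Only the forward half of a reduction is assumed, on a comeager set where
  \<open>f\<close> is continuous: equivalent points have equivalent images. That inequivalent points
  are separated enters only in the final theorem.\<close>

locale cli_homomorphism = polish_action G T X \<phi> + H: polish_action H S Y \<psi>
  for G (structure) and T :: "'g topology" and X :: "'x topology" and \<phi>
    and H and S :: "'h topology" and Y :: "'y topology" and \<psi> +
  fixes d :: "'h \<Rightarrow> 'h \<Rightarrow> real" and f :: "'x \<Rightarrow> 'y" and C :: "'x set"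
  assumes metric: "Metric_space (carrier H) d"
    and mtop: "Metric_space.mtopology (carrier H) d = S"
    and mcompl: "Metric_space.mcomplete (carrier H) d"
    and left_inv: "\<And>g h k. \<lbrakk>g \<in> carrier H; h \<in> carrier H; k \<in> carrier H\<rbrakk> \<Longrightarrow>
        d (g \<otimes>\<^bsub>H\<^esub> h) (g \<otimes>\<^bsub>H\<^esub> k) = d h k"
    and C_subset: "C \<subseteq> topspace X" and C_comeager: "meager_in X (topspace X - C)"
    and f_cont: "continuous_map (subtopology X C) Y f"
    and f_hom: "\<And>g z. \<lbrakk>g \<in> carrier G; z \<in> C; \<phi> g z \<in> C\<rbrakk> \<Longrightarrow> \<exists>h\<in>carrier H. f (\<phi> g z) = \<psi> h (f z)"
begin

sublocale H: Metric_space "carrier H" d by (rule metric)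

definition pairs where "pairs = {(g, z). g \<in> carrier G \<and> z \<in> C \<and> \<phi> g z \<in> C}"

text \<open>Stabilizers make \<open>a\<close> non-unique, hence the existential quantifier. It
  presents \<open>Rel K\<close> as a projection along \<open>H\<close>.\<close>

definition Rel where "Rel K = {(g, z) \<in> pairs. \<exists>a\<in>K. f (\<phi> g z) = \<psi> a (f z)}"

definition W where "W e = {w \<in> carrier H. d \<one>\<^bsub>H\<^esub> w \<le> e}"

lemma f_closed: "z \<in> C \<Longrightarrow> f z \<in> topspace Y"
  using continuous_map_funspace[OF f_cont] C_subset by auto

lemma pairs_subset: "pairs \<subseteq> topspace (prod_topology T X)"
  unfolding pairs_def using C_subset by auto

lemma pairs_comeager: "meager_in (prod_topology T X) (topspace (prod_topology T X) - pairs)"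
proof -
  have m: "meager_in (prod_topology T X) (topspace T \<times> (topspace X - C))"
    by (rule meager_in_Times[OF C_comeager])
  show ?thesis
    using meager_in_Un[OF m meager_in_homeomorphic_vimage[OF homeomorphic_map_graph m]]
    by (rule meager_in_mono) (auto simp: pairs_def)
qed

text \<open>Since \<open>f\<close> is continuous on \<open>C\<close>, the equation defining
  \<open>Rel K\<close> is closed in \<open>(g, z, a)\<close> over the comeager set
  \<open>pairs\<close>; projecting out \<open>a\<close> keeps the Baire property.\<close>

lemma Rel_baire_property:
  assumes K: "closedin S K"
  shows "baire_property (prod_topology T X) (Rel K)"
proof -
  let ?P = "prod_topology T X"
  let ?Z = "prod_topology (subtopology ?P pairs) S"
  define Q where "Q = {q \<in> topspace ?Z. f (\<phi> (fst (fst q)) (snd (fst q))) = \<psi> (snd q) (f (snd (fst q)))}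
      \<inter> {q \<in> topspace ?Z. snd q \<in> K}"
  have c_sub: "continuous_map ?Z ?P fst"
    using continuous_map_fst continuous_map_into_fulltopology by blast
  have c1: "continuous_map ?Z T (\<lambda>q. fst (fst q))"
    using continuous_map_compose[OF c_sub continuous_map_fst] by (simp add: o_def)
  have c2: "continuous_map ?Z X (\<lambda>q. snd (fst q))"
    using continuous_map_compose[OF c_sub continuous_map_snd] by (simp add: o_def)
  have c3: "continuous_map ?Z (subtopology X C) (\<lambda>q. snd (fst q))"
    using c2 by (auto simp: continuous_map_in_subtopology pairs_def)
  have c4: "continuous_map ?Z (subtopology X C) (\<lambda>q. \<phi> (fst (fst q)) (snd (fst q)))"
    using continuous_map_act[OF c1 c2] by (auto simp: continuous_map_in_subtopology pairs_def)
  have c5: "continuous_map ?Z Y (\<lambda>q. f (\<phi> (fst (fst q)) (snd (fst q))))"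
    using continuous_map_compose[OF c4 f_cont] by (simp add: o_def)
  have c6: "continuous_map ?Z Y (\<lambda>q. \<psi> (snd q) (f (snd (fst q))))"
    using continuous_map_compose[OF c3 f_cont] continuous_map_snd[of "subtopology ?P pairs" S]
    by (intro H.continuous_map_act) (auto simp: o_def)
  have "closedin ?Z Q"
    unfolding Q_def
    by (intro closedin_Int closedin_continuous_maps_eq[OF H.Hausdorff_X] c5 c6
        closedin_continuous_map_preimage[OF continuous_map_snd] K)
  then have "baire_property ?P (fst ` Q)"
    using H.polish_group
    by (intro H.baire_property_projection[OF second_countable_prod pairs_subset pairs_comeager mcompl])
      (auto simp: mtop polish_group_def polish_topology_def)
  moreover have "fst ` Q = Rel K"
  proof
    show "fst ` Q \<subseteq> Rel K" unfolding Q_def Rel_def by auto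
    show "Rel K \<subseteq> fst ` Q"
    proof
      fix p assume p: "p \<in> Rel K"
      then obtain g z a where a: "p = (g, z)" "(g, z) \<in> pairs" "a \<in> K" "f (\<phi> g z) = \<psi> a (f z)"
        unfolding Rel_def by auto
      moreover have "a \<in> carrier H" using closedin_subset[OF K] a(3) by auto
      ultimately have "((g, z), a) \<in> Q" unfolding Q_def using pairs_subset by auto
      then show "p \<in> fst ` Q" using a(1) by force
    qed
  qed
  ultimately show ?thesis by simp
qed

lemma d_inv: "w \<in> carrier H \<Longrightarrow> d \<one>\<^bsub>H\<^esub> (inv\<^bsub>H\<^esub> w) = d \<one>\<^bsub>H\<^esub> w"
  using left_inv[of w "\<one>\<^bsub>H\<^esub>" "inv\<^bsub>H\<^esub> w"] by (simp add: H.commute)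

text \<open>Countably many small closed sets \<open>K q\<close> cover \<open>H\<close>, so some
  \<open>Rel (K q)\<close> is comeager in a box \<open>V1 \<times> U1\<close>. Take a generic
  \<open>g0\<close> in \<open>V1\<close> and write \<open>z\<close> as the image of \<open>v\<close>
  under \<open>g0\<close>. For generic pairs near \<open>(\<one>, z)\<close>, both
  \<open>f (\<phi> g z)\<close> and \<open>f z\<close> arise from \<open>f v\<close> by elements
  \<open>a\<close>, \<open>b\<close> of \<open>K q\<close>, and \<open>a\<close> times the inverse
  of \<open>b\<close> lies in \<open>W e\<close>.\<close>

lemma locally_small_displacement:
  assumes e: "e > 0" and U0: "openin X U0" "U0 \<noteq> {}"
  obtains V U where "openin T V" "\<one> \<in> V" "openin X U" "U \<inter> U0 \<noteq> {}"
    "meager_in (prod_topology T X) (V \<times> U - Rel (W e))"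
proof -
  let ?P = "prod_topology T X"
  obtain Q where Q: "countable Q" "Q \<subseteq> carrier H" "S closure_of Q = carrier H"
    using H.polish_group unfolding polish_group_def polish_topology_def separable_space_def by auto
  \<comment> \<open>The inverse is there because left invariance gives \<open>d 1 (a b\<inverse>) = d (a\<inverse>) (b\<inverse>)\<close>, so that
    \<open>K q (K q)\<inverse> \<subseteq> W e\<close>.\<close>
  define K where "K q = {a \<in> carrier H. d q (inv\<^bsub>H\<^esub> a) \<le> e/2}" for q
  have K_closed: "closedin S (K q)" if "q \<in> Q" for q
  proof -
    have "continuous_map S S (\<lambda>a. inv\<^bsub>H\<^esub> a)" by (intro H.continuous_map_minv) simp
    moreover have "closedin S (H.mcball q (e/2))" using H.closedin_mcball mtop by metis
    ultimately have "closedin S {a \<in> topspace S. inv\<^bsub>H\<^esub> a \<in> H.mcball q (e/2)}"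
      by (rule closedin_continuous_map_preimage)
    moreover have "{a \<in> topspace S. inv\<^bsub>H\<^esub> a \<in> H.mcball q (e/2)} = K q"
      using that Q(2) unfolding K_def by auto
    ultimately show ?thesis by simp
  qed
  have K_cover: "\<exists>q\<in>Q. a \<in> K q" if "a \<in> carrier H" for a
  proof -
    have "inv\<^bsub>H\<^esub> a \<in> H.mtopology closure_of Q" using Q(3) mtop that by simp
    moreover have "e/2 > 0" using e by simp
    ultimately have "\<exists>q\<in>Q. q \<in> H.mball (inv\<^bsub>H\<^esub> a) (e/2)"
      unfolding H.metric_closure_of by blast
    then obtain q where "q \<in> Q" "d (inv\<^bsub>H\<^esub> a) q < e/2" by auto
    then show ?thesis unfolding K_def using that H.commute[of q "inv\<^bsub>H\<^esub> a"]
      by (intro bexI[of _ q]) auto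
  qed
  have K_W: "a \<otimes>\<^bsub>H\<^esub> inv\<^bsub>H\<^esub> b \<in> W e" if "q \<in> Q" "a \<in> K q" "b \<in> K q" for a b q
  proof -
    have ab: "a \<in> carrier H" "b \<in> carrier H" "q \<in> carrier H" using that Q(2) unfolding K_def by auto
    have "d \<one>\<^bsub>H\<^esub> (a \<otimes>\<^bsub>H\<^esub> inv\<^bsub>H\<^esub> b) = d (inv\<^bsub>H\<^esub> a) (inv\<^bsub>H\<^esub> b)"
      using left_inv[of a "inv\<^bsub>H\<^esub> a" "inv\<^bsub>H\<^esub> b"] ab by simp
    also have "\<dots> \<le> d (inv\<^bsub>H\<^esub> a) q + d q (inv\<^bsub>H\<^esub> b)" using ab by (intro H.triangle) auto
    also have "\<dots> \<le> e" using that(2,3) unfolding K_def by (simp add: H.commute)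
    finally show ?thesis unfolding W_def using ab by simp
  qed
  \<comment> \<open>The final \<open>U\<close> is the image of \<open>U1\<close> under
    \<open>g0\<close>. Choosing the box inside \<open>\<Omega>\<close> ensures that this image meets
    \<open>U0\<close>.\<close>
  define \<Omega> where "\<Omega> = {p \<in> topspace ?P. \<phi> (fst p) (snd p) \<in> U0}"
  have \<Omega>: "openin ?P \<Omega>" unfolding \<Omega>_def
    by (rule openin_continuous_map_preimage[OF continuous_map_act[OF continuous_map_fst continuous_map_snd] U0(1)])
  obtain u0 where u0: "u0 \<in> U0" "u0 \<in> topspace X" using U0 openin_subset by blast
  then have "(\<one>, u0) \<in> \<Omega>" unfolding \<Omega>_def by auto
  \<comment> \<open>Otherwise \<open>\<Omega>\<close> would be meager, being covered by these pieces
    and the meager complement of \<open>pairs\<close>; but it is open and nonempty.\<close>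
  obtain q where q: "q \<in> Q" "\<not> meager_in ?P (\<Omega> \<inter> Rel (K q))"
  proof (rule ccontr)
    assume "\<not> thesis"
    then have "meager_in ?P (\<Union>q\<in>Q. \<Omega> \<inter> Rel (K q))"
      using that Q(1) by (intro meager_in_UN) auto
    then have "meager_in ?P ((topspace ?P - pairs) \<union> (\<Union>q\<in>Q. \<Omega> \<inter> Rel (K q)))"
      by (rule meager_in_Un[OF pairs_comeager])
    moreover have "\<Omega> \<subseteq> (topspace ?P - pairs) \<union> (\<Union>q\<in>Q. \<Omega> \<inter> Rel (K q))"
    proof
      fix p assume p: "p \<in> \<Omega>"
      show "p \<in> (topspace ?P - pairs) \<union> (\<Union>q\<in>Q. \<Omega> \<inter> Rel (K q))"
      proof (cases "p \<in> pairs")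
        case True
        then obtain g z where gz: "p = (g, z)" "g \<in> carrier G" "z \<in> C" "\<phi> g z \<in> C"
          unfolding pairs_def by auto
        then obtain a where a: "a \<in> carrier H" "f (\<phi> g z) = \<psi> a (f z)" using f_hom by blast
        then obtain q where "q \<in> Q" "a \<in> K q" using K_cover by blast
        then show ?thesis using True a gz p unfolding Rel_def by auto
      qed (use p \<Omega> openin_subset in blast)
    qed
    ultimately have "meager_in ?P \<Omega>" by (rule meager_in_mono)
    then show False
      using meager_in_open_imp_empty[OF completely_metrizable_prod \<Omega>] \<open>(\<one>, u0) \<in> \<Omega>\<close> by blast
  qed
  obtain O1 where O1: "openin ?P O1" "meager_in ?P (Rel (K q) - O1)" "meager_in ?P (O1 - Rel (K q))"
    using Rel_baire_property[OF K_closed[OF q(1)]] unfolding baire_property_def by blast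
  have "\<Omega> \<inter> O1 \<noteq> {}"
  proof
    assume "\<Omega> \<inter> O1 = {}"
    then have "\<Omega> \<inter> Rel (K q) \<subseteq> Rel (K q) - O1" by blast
    then show False using q(2) O1(2) meager_in_mono by blast
  qed
  then obtain g1 u1 where "(g1, u1) \<in> \<Omega> \<inter> O1" by auto
  moreover have "openin ?P (\<Omega> \<inter> O1)" using \<Omega> O1(1) by blast
  ultimately obtain V1 U1 where VU1: "openin T V1" "openin X U1" "g1 \<in> V1" "u1 \<in> U1" "V1 \<times> U1 \<subseteq> \<Omega> \<inter> O1"
    unfolding openin_prod_topology_alt by meson
  define N where "N = V1 \<times> U1 - Rel (K q)"
  have N: "meager_in ?P N" unfolding N_def
    using O1(3) by (rule meager_in_mono) (use VU1(5) in blast)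
  \<comment> \<open>By Kuratowski-Ulam a generic \<open>g0\<close> satisfies
    \<open>(g0, v) \<in> Rel (K q)\<close> for comeagerly many \<open>v\<close> in
    \<open>U1\<close>, which supplies the comparison element \<open>b\<close>.\<close>
  obtain g0 where g0: "g0 \<in> V1" "meager_in X {z. (g0, z) \<in> N}"
  proof -
    obtain g where "g \<in> V1" "g \<notin> {g \<in> topspace T. \<not> meager_in X {z. (g, z) \<in> N}}"
      using ex_not_in_meager[OF completely_metrizable_group VU1(1) _ meager_in_sections'[OF second_countable_space N]]
        VU1(3) by blast
    then show thesis using that openin_subset[OF VU1(1)] by blast
  qed
  have g0G: "g0 \<in> carrier G" using g0(1) openin_subset[OF VU1(1)] by auto
  define V where "V = {g \<in> topspace T. g \<otimes> g0 \<in> V1}"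
  define U where "U = {z \<in> topspace X. \<phi> (inv g0) z \<in> U1}"
  have u1X: "u1 \<in> topspace X" using VU1(2,4) openin_subset by blast
  show thesis
  proof
    show "openin T V" unfolding V_def
      by (rule openin_continuous_map_preimage[OF homeomorphic_imp_continuous_map[OF homeomorphic_map_right_translation[OF g0G]] VU1(1)])
    show "\<one> \<in> V" unfolding V_def using g0(1) g0G by simp
    show "openin X U" unfolding U_def
      by (rule openin_continuous_map_preimage[OF homeomorphic_imp_continuous_map[OF homeomorphic_map_act] VU1(2)])
        (use g0G in simp)
    have "(g0, u1) \<in> \<Omega>" using VU1(4,5) g0(1) by blast
    then have "\<phi> g0 u1 \<in> U0" unfolding \<Omega>_def by simp
    moreover have "\<phi> g0 u1 \<in> U" unfolding U_def using VU1(4) g0G u1X by simp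
    ultimately show "U \<inter> U0 \<noteq> {}" by blast
    \<comment> \<open>With \<open>v\<close> the image of \<open>z\<close> under
      \<open>inv g0\<close>, \<open>?N1\<close> contains the failures of
      \<open>(g \<otimes> g0, v)\<close> and \<open>?N2\<close> those of
      \<open>(g0, v)\<close>.\<close>
    let ?N1 = "{p \<in> topspace ?P. (\<lambda>(g, z). (g \<otimes> g0, \<phi> (inv g0) z)) p \<in> N}"
    let ?N2 = "{z \<in> topspace X. \<phi> (inv g0) z \<in> {z. (g0, z) \<in> N}}"
    have "meager_in ?P ?N1"
      by (rule meager_in_homeomorphic_vimage[OF homeomorphic_map_shift[OF g0G] N])
    moreover have "meager_in ?P (topspace T \<times> ?N2)"
      by (intro meager_in_Times meager_in_homeomorphic_vimage[OF homeomorphic_map_act] g0(2)) (use g0G in simp)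
    ultimately have "meager_in ?P (?N1 \<union> topspace T \<times> ?N2)" by (rule meager_in_Un)
    then show "meager_in ?P (V \<times> U - Rel (W e))"
    proof (rule meager_in_mono)
      show "V \<times> U - Rel (W e) \<subseteq> ?N1 \<union> topspace T \<times> ?N2"
      proof (intro subsetI, rule ccontr)
        fix p assume p: "p \<in> V \<times> U - Rel (W e)" "p \<notin> ?N1 \<union> topspace T \<times> ?N2"
        obtain g z where "p = (g, z)" by (cases p)
        with p have gz: "g \<in> V" "z \<in> U" "(g, z) \<notin> Rel (W e)" "(g, z) \<notin> ?N1 \<union> topspace T \<times> ?N2"
          by blast+
        have gG: "g \<in> carrier G" and gV: "g \<otimes> g0 \<in> V1" using gz(1) unfolding V_def by auto
        have zX: "z \<in> topspace X" and zU: "\<phi> (inv g0) z \<in> U1" using gz(2) unfolding U_def by auto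
        let ?v = "\<phi> (inv g0) z"
        have "(g \<otimes> g0, ?v) \<notin> N" "(g0, ?v) \<notin> N" using gz(4) gG zX by auto
        then have r: "(g \<otimes> g0, ?v) \<in> Rel (K q)" "(g0, ?v) \<in> Rel (K q)"
          using gV zU g0(1) unfolding N_def by auto
        have e1: "\<phi> (g \<otimes> g0) ?v = \<phi> g z" using gG g0G zX by (simp add: act_act m_assoc)
        have e2: "\<phi> g0 ?v = z" using g0G zX by simp
        obtain a b where ab: "a \<in> K q" "b \<in> K q" "f (\<phi> g z) = \<psi> a (f ?v)" "f z = \<psi> b (f ?v)"
          and C: "?v \<in> C" "\<phi> g z \<in> C" "z \<in> C"
          using r e1 e2 unfolding Rel_def pairs_def by auto
        have abH: "a \<in> carrier H" "b \<in> carrier H" using ab unfolding K_def by auto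
        have "f ?v = \<psi> (inv\<^bsub>H\<^esub> b) (f z)" using ab(4) abH f_closed[OF C(1)] by simp
        then have "f (\<phi> g z) = \<psi> (a \<otimes>\<^bsub>H\<^esub> inv\<^bsub>H\<^esub> b) (f z)"
          using ab(3) abH f_closed[OF C(3)] by (simp add: H.act_act)
        moreover have "a \<otimes>\<^bsub>H\<^esub> inv\<^bsub>H\<^esub> b \<in> W e" using K_W q(1) ab by blast
        ultimately show False using gz(3) gG C unfolding Rel_def pairs_def by auto
      qed
    qed
  qed
qed

text \<open>Only countably many basic boxes occur, so the exceptional pairs of all boxes at all
  scales form one meager set \<open>N\<close>. Local smallness inside every open set makes the good
  centres \<open>Q k\<close> dense, and Kuratowski-Ulam turns meagerness of \<open>N\<close> into a
  statement about each single \<open>z\<close> outside a meager set.\<close>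

lemma generic_orbit_continuity:
  obtains C' where "C' \<subseteq> C" "meager_in X (topspace X - C')"
    "\<And>x k. x \<in> C' \<Longrightarrow> \<exists>U V. openin X U \<and> x \<in> U \<and> openin T V \<and> \<one> \<in> V \<and>
        (\<forall>z\<in>C' \<inter> U. meager_in T {g \<in> V. (g, z) \<notin> Rel (W ((1/2)^k))})"
proof -
  let ?P = "prod_topology T X"
  obtain \<B> where \<B>: "countable \<B>" "\<And>V. V \<in> \<B> \<Longrightarrow> openin T V"
      "\<And>U x. openin T U \<Longrightarrow> x \<in> U \<Longrightarrow> \<exists>V\<in>\<B>. x \<in> V \<and> V \<subseteq> U"
    using second_countable_group unfolding second_countable_def by metis
  obtain \<C> where \<C>: "countable \<C>" "\<And>V. V \<in> \<C> \<Longrightarrow> openin X V"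
      "\<And>U x. openin X U \<Longrightarrow> x \<in> U \<Longrightarrow> \<exists>V\<in>\<C>. x \<in> V \<and> V \<subseteq> U"
    using second_countable_space unfolding second_countable_def by metis
  define I where "I k = {(V, U) \<in> \<B> \<times> \<C>. meager_in ?P (V \<times> U - Rel (W ((1/2)^k)))}" for k :: nat
  define N where "N = (\<Union>k. \<Union>(V, U)\<in>I k. V \<times> U - Rel (W ((1/2)^k)))"
  have "countable (I k)" for k
    by (rule countable_subset[of _ "\<B> \<times> \<C>"]) (use \<B>(1) \<C>(1) in \<open>auto simp: I_def\<close>)
  then have N: "meager_in ?P N" unfolding N_def
    by (intro meager_in_UN) (auto simp: I_def)
  define Q where "Q k = \<Union>{U. \<exists>V. (V, U) \<in> I k \<and> \<one> \<in> V}" for k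
  have Q_open: "openin X (Q k)" for k unfolding Q_def I_def using \<C>(2) by auto
  have Q_meager: "meager_in X (topspace X - Q k)" for k
  proof (rule meager_in_closed)
    show "closedin X (topspace X - Q k)" using Q_open by blast
    show "X interior_of (topspace X - Q k) = {}"
    proof (rule ccontr)
      assume "X interior_of (topspace X - Q k) \<noteq> {}"
      then obtain V U where VU: "openin T V" "\<one> \<in> V" "openin X U" "U \<inter> X interior_of (topspace X - Q k) \<noteq> {}"
          "meager_in ?P (V \<times> U - Rel (W ((1/2)^k)))"
        using locally_small_displacement[of "(1/2)^k" "X interior_of (topspace X - Q k)"] by auto
      then obtain u where u: "u \<in> U" "u \<in> X interior_of (topspace X - Q k)" by blast
      obtain U' where U': "U' \<in> \<C>" "u \<in> U'" "U' \<subseteq> U" using \<C>(3)[OF VU(3) u(1)] by blast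
      obtain V' where V': "V' \<in> \<B>" "\<one> \<in> V'" "V' \<subseteq> V" using \<B>(3)[OF VU(1,2)] by blast
      have "meager_in ?P (V' \<times> U' - Rel (W ((1/2)^k)))"
        using VU(5) by (rule meager_in_mono) (use U' V' in blast)
      then have "(V', U') \<in> I k" unfolding I_def using U' V' by blast
      then have "u \<in> Q k" unfolding Q_def using V' U' by blast
      then show False using u(2) interior_of_subset[of X "topspace X - Q k"] by blast
    qed
  qed
  define E where "E = {z \<in> topspace X. \<not> meager_in T {g. (g, z) \<in> N}}"
  have E: "meager_in X E" unfolding E_def by (rule meager_in_sections[OF second_countable_group N])
  show thesis
  proof
    show "C \<inter> (\<Inter>k. Q k) - E \<subseteq> C" by blast
    have "meager_in X ((topspace X - C) \<union> ((\<Union>k. topspace X - Q k) \<union> E))"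
      using C_comeager Q_meager E by (intro meager_in_Un meager_in_UN) auto
    then show "meager_in X (topspace X - (C \<inter> (\<Inter>k. Q k) - E))"
      by (rule meager_in_mono) blast
    fix x and k :: nat assume "x \<in> C \<inter> (\<Inter>k. Q k) - E"
    then obtain V U where VU: "(V, U) \<in> I k" "\<one> \<in> V" "x \<in> U" unfolding Q_def by blast
    have "meager_in T {g \<in> V. (g, z) \<notin> Rel (W ((1/2)^k))}" if "z \<in> (C \<inter> (\<Inter>k. Q k) - E) \<inter> U" for z
    proof -
      have "meager_in T {g. (g, z) \<in> N}" using that C_subset unfolding E_def by blast
      then show ?thesis by (rule meager_in_mono) (use VU that in \<open>auto simp: N_def\<close>)
    qed
    then show "\<exists>U V. openin X U \<and> x \<in> U \<and> openin T V \<and> \<one> \<in> V \<and>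
        (\<forall>z\<in>(C \<inter> (\<Inter>k. Q k) - E) \<inter> U. meager_in T {g \<in> V. (g, z) \<notin> Rel (W ((1/2)^k))})"
      using VU \<B>(2) \<C>(2) unfolding I_def by blast
  qed
qed

end

section \<open>Playing the Becker-embedding game\<close>

context polish_action
begin

lemma orbit_eq_iff:
  assumes "x \<in> topspace X" "y \<in> topspace X"
  shows "orbit G \<phi> x = orbit G \<phi> y \<longleftrightarrow> (\<exists>g\<in>carrier G. y = \<phi> g x)"
proof
  assume "orbit G \<phi> x = orbit G \<phi> y"
  then have "y \<in> orbit G \<phi> x" using orbit_refl[OF assms(2)] by simp
  then show "\<exists>g\<in>carrier G. y = \<phi> g x" unfolding orbit_def by blast
next
  assume "\<exists>g\<in>carrier G. y = \<phi> g x"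
  then obtain g where g: "g \<in> carrier G" "y = \<phi> g x" by blast
  have "\<phi> h y = \<phi> (h \<otimes> g) x" if "h \<in> carrier G" for h
    using that g assms by (simp add: act_act)
  moreover have "\<phi> h x = \<phi> (h \<otimes> inv g) y" if "h \<in> carrier G" for h
    using that g assms by (simp add: act_act m_assoc)
  ultimately show "orbit G \<phi> x = orbit G \<phi> y"
    unfolding orbit_def using g(1) by (auto; metis m_closed)
qed

text \<open>Strategies and left products are eliminated here: from now on a play is a sequence of
  positions \<open>u n\<close>. The move \<open>g n\<close> is confined by \<open>V n\<close> and
  aims at \<open>U (Suc n)\<close>.\<close>

lemma becker_embeds_play:
  assumes emb: "becker_embeds G T X \<phi> x y" and y: "y \<in> topspace X"
    and legal: "emb_legal_I G T X x U V"
  obtains g u where "u 0 = y" "\<And>n. g n \<in> V n" "\<And>n. u (Suc n) = \<phi> (g n) (u n)"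
    "\<And>n. u (Suc n) \<in> U (Suc n)"
proof -
  obtain \<sigma> where "(\<forall>n\<ge>1. emb_response \<sigma> U V (n - 1) \<in> V (n - 1)) \<and>
        (\<forall>n\<ge>1. \<phi> (left_prod G (emb_response \<sigma> U V) n) y \<in> U n)"
    using emb legal unfolding becker_embeds_def by blast
  then have \<sigma>: "emb_response \<sigma> U V n \<in> V n"
      "\<phi> (left_prod G (emb_response \<sigma> U V) (Suc n)) y \<in> U (Suc n)" for n
    by (metis diff_Suc_1 le_add1 plus_1_eq_Suc)+
  let ?g = "emb_response \<sigma> U V"
  have V: "V n \<subseteq> carrier G" for n
    using legal openin_subset[of T "V n"] unfolding emb_legal_I_def by (cases n) auto
  have g: "?g n \<in> carrier G" for n using \<sigma>(1) V by blast
  have p: "left_prod G ?g n \<in> carrier G" for n by (induction n) (auto simp: g)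
  show thesis
  proof
    show "\<phi> (left_prod G ?g 0) y = y" using y by simp
    show "\<phi> (left_prod G ?g (Suc n)) y = \<phi> (?g n) (\<phi> (left_prod G ?g n) y)" for n
      using g p y by (simp add: act_act)
  qed (use \<sigma> in auto)
qed

text \<open>Moving both points by \<open>h\<close> preserves the embedding: Player I's sets in
  \<open>X\<close> are pulled back along \<open>\<phi> h\<close>, those in the group are conjugated
  by \<open>h\<close>. This allows \<open>x\<close> to be replaced by a generic point of its
  orbit.\<close>

lemma becker_embeds_play_translate:
  assumes emb: "becker_embeds G T X \<phi> x y" and x: "x \<in> topspace X" and y: "y \<in> topspace X"
    and h: "h \<in> carrier G" and legal: "emb_legal_I G T X (\<phi> h x) U V"
  obtains g u where "u 0 = \<phi> h y" "\<And>n. g n \<in> V n" "\<And>n. u (Suc n) = \<phi> (g n) (u n)"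
    "\<And>n. u (Suc n) \<in> U (Suc n)"
proof -
  define U' where "U' n = {z \<in> topspace X. \<phi> h z \<in> U n}" for n
  define V' where "V' n = {g \<in> topspace T. h \<otimes> g \<otimes> inv h \<in> V n}" for n
  have U'_open: "openin X (U' n)" if "openin X (U n)" for n
    unfolding U'_def
    by (rule openin_continuous_map_preimage[OF homeomorphic_imp_continuous_map[OF homeomorphic_map_act[OF h]] that])
  have V'_open: "openin T (V' n)" if "openin T (V n)" for n
    unfolding V'_def
    by (rule openin_continuous_map_preimage[OF _ that]) (use h in \<open>auto intro!: continuous_map_mult\<close>)
  have "emb_legal_I G T X x U' V'"
    using legal U'_open V'_open h x unfolding emb_legal_I_def
    by (auto simp: U'_def V'_def)
  then obtain g u where gu: "u 0 = y" "\<And>n. g n \<in> V' n" "\<And>n. u (Suc n) = \<phi> (g n) (u n)"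
      "\<And>n. u (Suc n) \<in> U' (Suc n)"
    using becker_embeds_play[OF emb y] by metis
  have g: "g n \<in> carrier G" for n using gu(2)[of n] unfolding V'_def by simp
  have u: "u n \<in> topspace X" for n by (induction n) (use gu(1,3) y g in auto)
  show thesis
  proof
    show "\<phi> h (u 0) = \<phi> h y" using gu by simp
    show "h \<otimes> g n \<otimes> inv h \<in> V n" for n using gu(2)[of n] unfolding V'_def by simp
    show "\<phi> h (u (Suc n)) = \<phi> (h \<otimes> g n \<otimes> inv h) (\<phi> h (u n))" for n
      using gu(3) g u h by (simp add: act_act m_assoc)
    show "\<phi> h (u (Suc n)) \<in> U (Suc n)" for n using gu(4)[of n] unfolding U'_def by simp
  qed
qed

text \<open>Continuity at \<open>(\<one>, x)\<close> and \<open>(\<one>, \<one>, \<one>)\<close>.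
  The product \<open>a \<otimes> (b \<otimes> inv c)\<close> is what a move \<open>b\<close> becomes
  once the positions before and after it are perturbed by \<open>c\<close> and
  \<open>a\<close>.\<close>

lemma small_neighbourhoods:
  assumes U: "openin X U" "x \<in> U" and V: "openin T V" "\<one> \<in> V"
  shows "\<exists>U' V'. openin X U' \<and> x \<in> U' \<and> openin T V' \<and> \<one> \<in> V' \<and> (\<forall>g\<in>V'. \<forall>z\<in>U'. \<phi> g z \<in> U) \<and>
    (\<forall>a\<in>V'. \<forall>b\<in>V'. \<forall>c\<in>V'. a \<otimes> (b \<otimes> inv c) \<in> V)"
proof -
  have xX: "x \<in> topspace X" using U openin_subset by blast
  let ?O = "{p \<in> topspace (prod_topology T X). \<phi> (fst p) (snd p) \<in> U}"
  have "openin (prod_topology T X) ?O"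
    by (rule openin_continuous_map_preimage[OF continuous_map_act[OF continuous_map_fst continuous_map_snd] U(1)])
  moreover have "(\<one>, x) \<in> ?O" using U xX by simp
  ultimately obtain V1 U1 where 1: "openin T V1" "openin X U1" "\<one> \<in> V1" "x \<in> U1" "V1 \<times> U1 \<subseteq> ?O"
    unfolding openin_prod_topology_alt by meson
  let ?T = "prod_topology T (prod_topology T T)"
  let ?Q = "{p \<in> topspace ?T. fst p \<otimes> (fst (snd p) \<otimes> inv (snd (snd p))) \<in> V}"
  have f: "continuous_map ?T T (\<lambda>p. fst (snd p))" "continuous_map ?T T (\<lambda>p. snd (snd p))"
    using continuous_map_compose[OF continuous_map_snd continuous_map_fst, of T T T]
      continuous_map_compose[OF continuous_map_snd continuous_map_snd, of T T T] by (auto simp: o_def)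
  have "openin ?T ?Q"
    by (rule openin_continuous_map_preimage[OF _ V(1)])
      (intro continuous_map_mult continuous_map_minv f continuous_map_fst)
  moreover have "(\<one>, \<one>, \<one>) \<in> ?Q" using V by simp
  ultimately obtain V2 V' where 2: "openin T V2" "openin (prod_topology T T) V'" "\<one> \<in> V2" "(\<one>, \<one>) \<in> V'"
      "V2 \<times> V' \<subseteq> ?Q"
    unfolding openin_prod_topology_alt[of T] by meson
  from 2(2,4) obtain V3 V4 where 3: "openin T V3" "openin T V4" "\<one> \<in> V3" "\<one> \<in> V4" "V3 \<times> V4 \<subseteq> V'"
    unfolding openin_prod_topology_alt by meson
  let ?W = "V1 \<inter> V2 \<inter> V3 \<inter> V4"
  show ?thesis
  proof (intro exI[of _ U1] exI[of _ ?W] conjI ballI)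
    show "openin X U1" "x \<in> U1" by fact+
    show "openin T ?W" using 1 2 3 by blast
    show "\<one> \<in> ?W" using 1 2 3 by blast
    show "\<phi> g z \<in> U" if "g \<in> ?W" "z \<in> U1" for g z
      using 1(5) that by auto
    show "a \<otimes> (b \<otimes> inv c) \<in> V" if "a \<in> ?W" "b \<in> ?W" "c \<in> ?W" for a b c
    proof -
      have "(a, b, c) \<in> V2 \<times> V'" using that 3(5) by blast
      then show ?thesis using 2(5) by auto
    qed
  qed
qed

end

section \<open>Convergence of the images of a play\<close>

context cli_homomorphism
begin

lemma cli_limit_in_orbit:
  assumes v: "\<And>n. v n \<in> topspace Y" and w: "\<And>n. w n \<in> W ((1/2)^n)"
    and step: "\<And>n. v (Suc n) = \<psi> (w n) (v n)" and lim: "limitin Y v l sequentially"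
  shows "\<exists>k\<in>carrier H. v 0 = \<psi> k l"
proof -
  \<comment> \<open>\<open>k n\<close> is the inverse of the product of \<open>w (n-1)\<close>, ...,
    \<open>w 0\<close>, so it carries \<open>v n\<close> back to \<open>v 0\<close>. Left invariance
    bounds right multiplication by a small factor, hence these inverses, and not the products, are
    shown to be Cauchy.\<close>
  define k where "k = rec_nat \<one>\<^bsub>H\<^esub> (\<lambda>n a. a \<otimes>\<^bsub>H\<^esub> inv\<^bsub>H\<^esub> w n)"
  have k0: "k 0 = \<one>\<^bsub>H\<^esub>" and kS: "k (Suc n) = k n \<otimes>\<^bsub>H\<^esub> inv\<^bsub>H\<^esub> w n" for n
    unfolding k_def by simp_all
  have wH: "w n \<in> carrier H" and wd: "d \<one>\<^bsub>H\<^esub> (w n) \<le> (1/2)^n" for n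
    using w[of n] unfolding W_def by auto
  have kH: "k n \<in> carrier H" for n by (induction n) (auto simp: k0 kS wH)
  have vk: "\<psi> (k n) (v n) = v 0" for n
  proof (induction n)
    case (Suc n)
    have "\<psi> (k (Suc n)) (v (Suc n)) = \<psi> (k n) (v n)"
      using kH wH v by (simp add: kS step H.act_act H.m_assoc)
    then show ?case using Suc by simp
  qed (use v in \<open>simp add: k0\<close>)
  have kd: "d (k n) (k (Suc n)) \<le> (1/2)^n" for n
    using left_inv[of "k n" "\<one>\<^bsub>H\<^esub>" "inv\<^bsub>H\<^esub> w n"] kH wH wd d_inv[of "w n"] by (simp add: kS)
  \<comment> \<open>The exact value of the geometric sum lets the induction close.\<close>
  have kdm: "d (k n) (k (n + m)) \<le> 2 * (1/2)^n - 2 * (1/2)^(n + m)" for n m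
  proof (induction m)
    case (Suc m)
    show ?case
      using Suc kd[of "n + m"] H.triangle[OF kH[of n] kH[of "n + m"] kH[of "n + Suc m"]] by simp
  qed (use kH in simp)
  have kd2: "d (k n) (k m) \<le> 2 * (1/2)^n" if "n \<le> m" for n m
  proof -
    have "d (k n) (k m) \<le> 2 * (1/2)^n - 2 * (1/2)^m" using kdm[of n "m - n"] that by simp
    moreover have "0 \<le> 2 * (1/2::real)^m" by simp
    ultimately show ?thesis by linarith
  qed
  have "H.MCauchy k"
    unfolding H.MCauchy_def
  proof (intro conjI allI impI)
    show "range k \<subseteq> carrier H" using kH by blast
    fix e :: real assume "e > 0"
    then obtain N where N: "(1/2)^N < e/4" using real_arch_pow_inv[of "e/4" "1/2"] by auto
    have "d (k n) (k n') < e" if "N \<le> n" "N \<le> n'" for n n'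
      using H.triangle[OF kH[of n] kH[of N] kH[of n']] kd2[OF that(1)] kd2[OF that(2)] N
        H.commute[of "k n" "k N"] by simp
    then show "\<exists>N. \<forall>n n'. N \<le> n \<longrightarrow> N \<le> n' \<longrightarrow> d (k n) (k n') < e" by blast
  qed
  then obtain a where a: "limitin S k a sequentially"
    using mcompl mtop unfolding H.mcomplete_def by auto
  then have aH: "a \<in> carrier H" using limitin_topspace by fastforce
  \<comment> \<open>Joint continuity of the action passes \<open>\<psi> (k n) (v n) = v 0\<close> to
    the limit.\<close>
  have "limitin (prod_topology S Y) (\<lambda>n. (k n, v n)) (a, l) sequentially"
    using a lim by (simp add: limitin_pairwise o_def)
  from continuous_map_limit[OF H.continuous_map_act[OF continuous_map_fst continuous_map_snd] this]
  have "limitin Y (\<lambda>n. v 0) (\<psi> a l) sequentially" by (simp add: o_def vk)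
  moreover have "limitin Y (\<lambda>n. v 0) (v 0) sequentially" using v by simp
  ultimately have "v 0 = \<psi> a l"
    using limitin_Hausdorff_unique[OF _ _ _ H.Hausdorff_X] trivial_limit_sequentially by metis
  then show ?thesis using aH by blast
qed

text \<open>The conclusion concerns translates because \<open>x\<close> and \<open>y\<close>
  themselves need not lie in \<open>C\<close>, where \<open>f\<close> is controlled. Perturbed
  positions of one play, in which Player I uses ever smaller good neighbourhoods, have images
  satisfying \<open>cli_limit_in_orbit\<close>.\<close>

lemma becker_embeds_imp_orbit:
  assumes C': "C' \<subseteq> C"
    and cont: "\<And>x k. x \<in> C' \<Longrightarrow> \<exists>U V. openin X U \<and> x \<in> U \<and> openin T V \<and> \<one> \<in> V \<and>
        (\<forall>z\<in>C' \<inter> U. meager_in T {g \<in> V. (g, z) \<notin> Rel (W ((1/2)^k))})"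
    and D: "D \<subseteq> topspace X" "\<And>g z. g \<in> carrier G \<Longrightarrow> z \<in> D \<Longrightarrow> \<phi> g z \<in> D"
      "\<And>z. z \<in> D \<Longrightarrow> meager_in T {g \<in> carrier G. \<phi> g z \<notin> C'}"
    and xy: "x \<in> D" "y \<in> D" and emb: "becker_embeds G T X \<phi> x y"
  obtains g h k where "g \<in> carrier G" "h \<in> carrier G" "\<phi> g x \<in> C" "\<phi> h y \<in> C"
    "k \<in> carrier H" "f (\<phi> h y) = \<psi> k (f (\<phi> g x))"
proof -
  have xX: "x \<in> topspace X" and yX: "y \<in> topspace X" using xy D(1) by auto
  have "openin T (carrier G)" using openin_topspace[of T] by simp
  then obtain h0 where h0: "h0 \<in> carrier G" "\<phi> h0 x \<in> C'"
    using ex_not_in_meager[OF completely_metrizable_group _ _ D(3)[OF xy(1)], of "carrier G"] by blast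
  define x' where "x' = \<phi> h0 x"
  have x': "x' \<in> C'" using h0 unfolding x'_def by simp
  obtain M \<rho> where M: "Metric_space M \<rho>" and Y: "Y = Metric_space.mtopology M \<rho>"
    using H.completely_metrizable_space completely_metrizable_imp_metrizable_space
    unfolding metrizable_space_def by blast
  interpret M: Metric_space M \<rho> by (rule M)
  have MY: "M = topspace Y" unfolding Y by simp
  \<comment> \<open>The displacement bound makes the group elements between consecutive images
    summable; the distance bound makes the images converge to \<open>f x'\<close>.\<close>
  define good where "good k U V \<longleftrightarrow> openin X U \<and> x' \<in> U \<and> openin T V \<and> \<one> \<in> V \<and>
        (\<forall>z\<in>C' \<inter> U. meager_in T {g \<in> V. (g, z) \<notin> Rel (W ((1/2)^k))} \<and> \<rho> (f z) (f x') < (1/2)^k)"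
    for k :: nat and U V
  have "\<exists>U V. good k U V" for k
  proof -
    obtain U V where UV: "openin X U" "x' \<in> U" "openin T V" "\<one> \<in> V"
        "\<forall>z\<in>C' \<inter> U. meager_in T {g \<in> V. (g, z) \<notin> Rel (W ((1/2)^k))}"
      using cont[OF x', of k] by blast
    have fx: "f x' \<in> M" using f_closed x' C' MY by blast
    have "openin Y (M.mball (f x') ((1/2)^k))" unfolding Y by simp
    then have "openin (subtopology X C) {z \<in> topspace (subtopology X C). f z \<in> M.mball (f x') ((1/2)^k)}"
      by (rule openin_continuous_map_preimage[OF f_cont])
    then obtain O' where O': "openin X O'"
        "{z \<in> topspace (subtopology X C). f z \<in> M.mball (f x') ((1/2)^k)} = O' \<inter> C"
      unfolding openin_subtopology by auto
    have "x' \<in> {z \<in> topspace (subtopology X C). f z \<in> M.mball (f x') ((1/2)^k)}"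
      using x' C' C_subset fx by auto
    then have "x' \<in> O'" using O'(2) by blast
    moreover have "\<rho> (f z) (f x') < (1/2)^k" if "z \<in> C' \<inter> (U \<inter> O')" for z
    proof -
      have "z \<in> O' \<inter> C" using that C' by blast
      then have "f z \<in> M.mball (f x') ((1/2)^k)" using O'(2) by blast
      then show ?thesis by (simp add: M.commute)
    qed
    ultimately show ?thesis using UV O'(1) unfolding good_def
      by (intro exI[of _ "U \<inter> O'"] exI[of _ V]) auto
  qed
  then obtain U1 V1 where "\<And>k. good k (U1 k) (V1 k)" by metis
  then have UV1: "\<And>k. openin X (U1 k)" "\<And>k. x' \<in> U1 k" "\<And>k. openin T (V1 k)" "\<And>k. \<one> \<in> V1 k"
      "\<And>k z. z \<in> C' \<Longrightarrow> z \<in> U1 k \<Longrightarrow> meager_in T {g \<in> V1 k. (g, z) \<notin> Rel (W ((1/2)^k))}"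
      "\<And>k z. z \<in> C' \<Longrightarrow> z \<in> U1 k \<Longrightarrow> \<rho> (f z) (f x') < (1/2)^k"
    unfolding good_def by blast+
  \<comment> \<open>Player I plays these smaller sets, so that perturbed positions and moves still
    fall into \<open>U1\<close> and \<open>V1\<close>.\<close>
  define small where "small k U V \<longleftrightarrow> openin X U \<and> x' \<in> U \<and> openin T V \<and> \<one> \<in> V \<and>
      (\<forall>g\<in>V. \<forall>z\<in>U. \<phi> g z \<in> U1 k) \<and> (\<forall>a\<in>V. \<forall>b\<in>V. \<forall>c\<in>V. a \<otimes> (b \<otimes> inv c) \<in> V1 k)"
    for k U V
  have "\<exists>U V. small k U V" for k
    unfolding small_def by (intro small_neighbourhoods UV1)
  then obtain U V where "\<And>k. small k (U k) (V k)" by metis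
  then have UV: "\<And>k. openin X (U k)" "\<And>k. x' \<in> U k" "\<And>k. openin T (V k)" "\<And>k. \<one> \<in> V k"
      "\<And>k g z. g \<in> V k \<Longrightarrow> z \<in> U k \<Longrightarrow> \<phi> g z \<in> U1 k"
      "\<And>k a b c. a \<in> V k \<Longrightarrow> b \<in> V k \<Longrightarrow> c \<in> V k \<Longrightarrow> a \<otimes> (b \<otimes> inv c) \<in> V1 k"
    unfolding small_def by blast+
  have VG: "V k \<subseteq> carrier G" for k using openin_subset[OF UV(3)] by simp
  \<comment> \<open>Index shift: the sets of scale \<open>n\<close> are played at turn
    \<open>n + 1\<close>. The first answer \<open>g 0\<close> is unrestricted, so all estimates
    begin at \<open>u (Suc 0)\<close>, and \<open>g (Suc n)\<close> lies in
    \<open>V n\<close>.\<close>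
  have "emb_legal_I G T X (\<phi> h0 x) (case_nat (topspace X) U) (case_nat (carrier G) V)"
    unfolding emb_legal_I_def using UV(1-4) x'_def by (auto split: nat.split)
  then obtain g u where gu: "u 0 = \<phi> h0 y" "\<And>n. g n \<in> case_nat (carrier G) V n"
      "\<And>n. u (Suc n) = \<phi> (g n) (u n)" "\<And>n. u (Suc n) \<in> case_nat (topspace X) U (Suc n)"
    using becker_embeds_play_translate[OF emb xX yX h0(1)] by metis
  have gG: "g n \<in> carrier G" for n using gu(2)[of n] VG by (cases n) auto
  have gV: "g (Suc n) \<in> V n" for n using gu(2)[of "Suc n"] by simp
  have uU: "u (Suc n) \<in> U n" for n using gu(4)[of n] by simp
  have uD: "u n \<in> D" for n by (induction n) (use gu(1,3) gG h0(1) xy D(2) in auto)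
  have uX: "u n \<in> topspace X" for n using uD D(1) by blast
  \<comment> \<open>The positions \<open>u n\<close> of the play need not lie in \<open>C'\<close>; the \<open>e n\<close> move them there without leaving
    the neighbourhoods on which \<open>f\<close> has small displacement.\<close>
  have "\<exists>e. \<forall>n. (e n \<in> V n \<and> \<phi> (e n) (u (Suc n)) \<in> C') \<and>
      (e (Suc n) \<otimes> (g (Suc n) \<otimes> inv e n), \<phi> (e n) (u (Suc n))) \<in> Rel (W ((1/2)^n))"
  proof (rule dependent_nat_choice)
    obtain e where "e \<in> V 0" "e \<notin> {g \<in> carrier G. \<phi> g (u (Suc 0)) \<notin> C'}"
      using ex_not_in_meager[OF completely_metrizable_group UV(3) _ D(3)[OF uD]] UV(4) by blast
    then show "\<exists>e. e \<in> V 0 \<and> \<phi> e (u (Suc 0)) \<in> C'" using VG by blast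
  next
    fix e n assume e: "e \<in> V n \<and> \<phi> e (u (Suc n)) \<in> C'"
    then have eG: "e \<in> carrier G" using VG by blast
    let ?z = "\<phi> e (u (Suc n))" and ?t = "g (Suc n) \<otimes> inv e"
    have tG: "?t \<in> carrier G" using gG eG by simp
    let ?B1 = "{a \<in> carrier G. \<phi> a (u (Suc (Suc n))) \<notin> C'}"
    let ?B2 = "{a \<in> topspace T. a \<otimes> ?t \<in> {b \<in> V1 n. (b, ?z) \<notin> Rel (W ((1/2)^n))}}"
    have "?z \<in> U1 n" using UV(5) uU e by blast
    then have "meager_in T {b \<in> V1 n. (b, ?z) \<notin> Rel (W ((1/2)^n))}" using UV1(5) e by blast
    from meager_in_homeomorphic_vimage[OF homeomorphic_map_right_translation[OF tG] this]
    have "meager_in T (?B1 \<union> ?B2)" using D(3)[OF uD] by (intro meager_in_Un)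
    \<comment> \<open>The new perturbation must lie in \<open>V n\<close> to bound the present step
      and in \<open>V (Suc n)\<close> to continue the induction.\<close>
    moreover have "openin T (V n \<inter> V (Suc n))" "V n \<inter> V (Suc n) \<noteq> {}" using UV(3,4) by blast+
    ultimately obtain a where a: "a \<in> V n \<inter> V (Suc n)" "a \<notin> ?B1 \<union> ?B2"
      using ex_not_in_meager[OF completely_metrizable_group, of "V n \<inter> V (Suc n)" "?B1 \<union> ?B2"] by blast
    have aG: "a \<in> carrier G" using a(1) VG by blast
    have "a \<otimes> ?t \<in> V1 n" using UV(6) a(1) gV e by blast
    then have "(a \<otimes> ?t, ?z) \<in> Rel (W ((1/2)^n))" using a(2) aG by auto
    moreover have "\<phi> a (u (Suc (Suc n))) \<in> C'" using a(2) aG by blast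
    ultimately show "\<exists>e'. (e' \<in> V (Suc n) \<and> \<phi> e' (u (Suc (Suc n))) \<in> C') \<and>
        (e' \<otimes> (g (Suc n) \<otimes> inv e), \<phi> e (u (Suc n))) \<in> Rel (W ((1/2)^n))"
      using a(1) by blast
  qed
  then obtain e where e: "\<And>n. e n \<in> V n" "\<And>n. \<phi> (e n) (u (Suc n)) \<in> C'"
      "\<And>n. (e (Suc n) \<otimes> (g (Suc n) \<otimes> inv e n), \<phi> (e n) (u (Suc n))) \<in> Rel (W ((1/2)^n))"
    by blast
  have eG: "e n \<in> carrier G" for n using e(1) VG by blast
  define v where "v n = f (\<phi> (e n) (u (Suc n)))" for n
  have "\<exists>w\<in>W ((1/2)^n). v (Suc n) = \<psi> w (v n)" for n
  proof -
    \<comment> \<open>Undo the old perturbation, make the move of the play, perturb again.\<close>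
    have "\<phi> (e (Suc n) \<otimes> (g (Suc n) \<otimes> inv e n)) (\<phi> (e n) (u (Suc n))) = \<phi> (e (Suc n)) (u (Suc (Suc n)))"
      using eG gG uX gu(3)[of "Suc n"] by (simp add: act_act m_assoc del: gu(3))
    then show ?thesis using e(3)[of n] unfolding Rel_def v_def by auto
  qed
  then obtain w where w: "\<And>n. w n \<in> W ((1/2)^n)" "\<And>n. v (Suc n) = \<psi> (w n) (v n)" by metis
  have vY: "v n \<in> topspace Y" for n unfolding v_def using f_closed e(2) C' by blast
  have v_close: "\<rho> (v n) (f x') < (1/2)^n" for n
    unfolding v_def using UV1(6) e(1,2) UV(5) uU by blast
  have "limitin Y v (f x') sequentially"
    unfolding Y M.limit_metric_sequentially
  proof (intro conjI allI impI)
    show "f x' \<in> M" using f_closed x' C' MY by blast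
    fix r :: real assume "r > 0"
    then obtain N where N: "(1/2)^N < r" using real_arch_pow_inv[of r "1/2"] by auto
    have "v n \<in> M \<and> \<rho> (v n) (f x') < r" if "n \<ge> N" for n
    proof -
      have "(1/2::real)^n \<le> (1/2)^N" using that by (intro power_decreasing) auto
      then have "\<rho> (v n) (f x') < r" using v_close[of n] N by linarith
      then show ?thesis using vY MY by simp
    qed
    then show "\<exists>N. \<forall>n\<ge>N. v n \<in> M \<and> \<rho> (v n) (f x') < r" by blast
  qed
  from cli_limit_in_orbit[OF vY w this] obtain k where k: "k \<in> carrier H" "v 0 = \<psi> k (f x')" by blast
  \<comment> \<open>The unrestricted first move does no harm: it keeps the starting position of the
    estimates in the orbit of \<open>y\<close>.\<close>
  have "\<phi> (e 0) (u (Suc 0)) = \<phi> (e 0 \<otimes> g 0 \<otimes> h0) y"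
    using gu(1) gu(3)[of 0] eG gG h0(1) yX by (simp add: act_act m_assoc)
  then have "\<phi> (e 0 \<otimes> g 0 \<otimes> h0) y \<in> C" "f (\<phi> (e 0 \<otimes> g 0 \<otimes> h0) y) = \<psi> k (f (\<phi> h0 x))"
    using e(2)[of 0] C' k(2) unfolding v_def x'_def by auto
  then show thesis using that[of h0 "e 0 \<otimes> g 0 \<otimes> h0" k] h0 k(1) C' eG gG by auto
qed

end

section \<open>A Borel reduction contradicts the Becker embeddings\<close>

theorem theorem2p9:
  fixes G :: "('g, 'm) monoid_scheme" and T :: "'g topology"
    and X :: "'x topology" and \<phi> :: "'g \<Rightarrow> 'x \<Rightarrow> 'x"
  assumes "polish_group G T"
    and "polish_G_space G T X \<phi>"
    and "\<And>C. invariant_dense_gdelta G X \<phi> C \<Longrightarrow>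
           \<exists>x\<in>C. \<exists>y\<in>C. orbit G \<phi> x \<noteq> orbit G \<phi> y \<and> becker_embeds G T X \<phi> x y"
  shows "\<forall>C. invariant_dense_gdelta G X \<phi> C \<longrightarrow>
           \<not> cli_classifiable TYPE('h) TYPE('y)
               (borel_of (subtopology X C)) (orbit_eq_rel G X \<phi> \<inter> C \<times> C)"
proof (intro allI impI notI)
  fix C0 assume C0: "invariant_dense_gdelta G X \<phi> C0"
    and "cli_classifiable TYPE('h) TYPE('y) (borel_of (subtopology X C0)) (orbit_eq_rel G X \<phi> \<inter> C0 \<times> C0)"
  then obtain H :: "'h monoid" and S and Y :: "'y topology" and \<psi> f
    where H: "cli_group H S" "polish_G_space H S Y \<psi>"
      and f: "f \<in> measurable (borel_of (subtopology X C0)) (borel_of Y)"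
      and red: "\<forall>x\<in>space (borel_of (subtopology X C0)). \<forall>y\<in>space (borel_of (subtopology X C0)).
          (x, y) \<in> orbit_eq_rel G X \<phi> \<inter> C0 \<times> C0 \<longleftrightarrow> (f x, f y) \<in> orbit_eq_rel H Y \<psi>"
    unfolding cli_classifiable_def borel_reducible_def by blast
  interpret polish_action G T X \<phi> by unfold_locales (use assms in auto)
  interpret H: polish_action H S Y \<psi> by unfold_locales (use H in \<open>auto simp: cli_group_def\<close>)
  have C0X: "C0 \<subseteq> topspace X" and C0m: "meager_in X (topspace X - C0)"
    using C0 dense_gdelta_comeager gdelta_in_subset unfolding invariant_dense_gdelta_def by blast+
  have "space (borel_of (subtopology X C0)) = C0"
    unfolding borel_of_def using C0X by (auto simp: space_measure_of_conv)
  with red have red: "orbit G \<phi> x = orbit G \<phi> y \<longleftrightarrow> f x \<in> topspace Y \<and> f y \<in> topspace Y \<and> orbit H \<psi> (f x) = orbit H \<psi> (f y)"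
    if "x \<in> C0" "y \<in> C0" for x y
    using that C0X unfolding orbit_eq_rel_def by auto
  obtain C where C: "C \<subseteq> C0" "meager_in X (topspace X - C)" "continuous_map (subtopology X C) Y f"
    by (rule borel_measurable_continuous_on_comeager[OF C0X C0m H.second_countable_space f])
  obtain d where d: "Metric_space (carrier H) d" "Metric_space.mtopology (carrier H) d = S"
      "Metric_space.mcomplete (carrier H) d"
      "\<forall>g\<in>carrier H. \<forall>h\<in>carrier H. \<forall>k\<in>carrier H. d (g \<otimes>\<^bsub>H\<^esub> h) (g \<otimes>\<^bsub>H\<^esub> k) = d h k"
    using H(1) unfolding cli_group_def by blast
  interpret cli_homomorphism G T X \<phi> H S Y \<psi> d f C
  proof (intro cli_homomorphism.intro cli_homomorphism_axioms.intro polish_action_axioms H.polish_action_axioms)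
    fix g z assume gz: "g \<in> carrier G" "z \<in> C" "\<phi> g z \<in> C"
    then have "orbit G \<phi> z = orbit G \<phi> (\<phi> g z)" using orbit_eq_iff C(1) C0X by blast
    then show "\<exists>h\<in>carrier H. f (\<phi> g z) = \<psi> h (f z)"
      using red[of z "\<phi> g z"] H.orbit_eq_iff gz C(1) by blast
  qed (use C C0X d in auto)
  obtain C' where C': "C' \<subseteq> C" "meager_in X (topspace X - C')"
    "\<And>x k. x \<in> C' \<Longrightarrow> \<exists>U V. openin X U \<and> x \<in> U \<and> openin T V \<and> \<one>\<^bsub>G\<^esub> \<in> V \<and>
        (\<forall>z\<in>C' \<inter> U. meager_in T {g \<in> V. (g, z) \<notin> Rel (W ((1/2)^k))})"
    using generic_orbit_continuity by blast
  obtain D where D: "invariant_dense_gdelta G X \<phi> D"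
    "\<And>z. z \<in> D \<Longrightarrow> meager_in T {g \<in> carrier G. \<phi> g z \<notin> C'}"
    using invariant_dense_gdelta_Vaught[OF C'(2)] by blast
  have DX: "D \<subseteq> topspace X" and D_inv: "\<And>g z. g \<in> carrier G \<Longrightarrow> z \<in> D \<Longrightarrow> \<phi> g z \<in> D"
    using D(1) gdelta_in_subset unfolding invariant_dense_gdelta_def by blast+
  \<comment> \<open>The hypothesis is applied to \<open>D\<close>, not to \<open>C0\<close>, so that
    comeagerly many translates of both points lie in \<open>C'\<close>.\<close>
  obtain x y where xy: "x \<in> D" "y \<in> D" "orbit G \<phi> x \<noteq> orbit G \<phi> y" "becker_embeds G T X \<phi> x y"
    using assms(3)[OF D(1)] by blast
  obtain g h k where k: "g \<in> carrier G" "h \<in> carrier G" "\<phi> g x \<in> C" "\<phi> h y \<in> C"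
    "k \<in> carrier H" "f (\<phi> h y) = \<psi> k (f (\<phi> g x))"
    by (rule becker_embeds_imp_orbit[OF C'(1,3) DX D_inv D(2) xy(1,2,4)])
  have xyX: "x \<in> topspace X" "y \<in> topspace X" using xy DX by auto
  have "orbit H \<psi> (f (\<phi> g x)) = orbit H \<psi> (f (\<phi> h y))"
    using H.orbit_eq_iff f_closed k by blast
  \<comment> \<open>The backward half of the reduction: equivalent images come from equivalent
    points.\<close>
  then have "orbit G \<phi> (\<phi> g x) = orbit G \<phi> (\<phi> h y)"
    using red[of "\<phi> g x" "\<phi> h y"] C(1) f_closed k by blast
  moreover have "orbit G \<phi> x = orbit G \<phi> (\<phi> g x)" "orbit G \<phi> y = orbit G \<phi> (\<phi> h y)"
    using orbit_eq_iff xyX k(1,2) act_closed by blast+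
  ultimately show False using xy(3) by simp
qed

end
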